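(* Let $F$ be a free group (possibly not finitely generated). An element $x\in F$ is separable if and only if for every free basis $B$ of $F$ the Whitehead graph $\mathrm{Wh}_B(x)$ is not connected or has a cut-vertex.
   Context: An element $x\in F$ is separable if there are non-trivial free factors $F_1,F_2$ of $F$ with $F=F_1*F_2$ such that $x$ can be conjugated into $F_1$ or $F_2$. Whitehead graph: let $B$ be a free basis of $F$ (with the convention that $b\in B$ implies $b^{-1}\notin B$). If $w=w_1w_2\cdots w_n$ is the reduced expression in $B$ of a cyclically reduced word $w$, then $\mathrm{Wh}_B(w)$ is the graph with two vertices labeled $b$ and $b^{-1}$ for every $b\in B$, and with an edge from $w_i$ to $w_{i+1}^{-1}$ for every two consecutive letters $w_i,w_{i+1}$ of $w$, where $w_n,w_1$ are also regarded as consecutive, giving an edge from $w_n$ to $w_1^{-1}$. For general $w\in F$, $\mathrm{Wh}_B(w):=\mathrm{Wh}_B(r_B(w))$, where $r_B(w)$ is the cyclically reduced word in the conjugacy class of $w$ (unique up to cyclic permutation, which does not affect the graph). A vertex $v$ of a graph is a cut-vertex if the graph has more connected components after removing $v$.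
   Formalization: The case F infinite cyclic with x = 1 is excluded: there 1 is not separable, yet every Whitehead graph of 1 is two isolated vertices, hence not connected, so the claim fails. For trivial F the empty Whitehead graph counts as connected. *)

theory Defs
  imports
    "HOL-Algebra.Algebra"
    "HOL-Library.Equipollence"
    "Graph_Theory.Digraph_Component"
begin

section \<open>Words and free bases\<close>

text \<open>
  A word over \<open>B\<close> is a list of letters, where a letter is an element \<open>b\<close> of \<open>B\<close> or its inverse,
  taken in the group itself.
\<close>

definition letters :: "('a, 'm) monoid_scheme \<Rightarrow> 'a set \<Rightarrow> 'a set" where
  "letters G B = B \<union> (\<lambda>b. inv\<^bsub>G\<^esub> b) ` B"

definition word_prod :: "('a, 'm) monoid_scheme \<Rightarrow> 'a list \<Rightarrow> 'a" where
  "word_prod G w = foldr (\<otimes>\<^bsub>G\<^esub>) w \<one>\<^bsub>G\<^esub>"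

definition reduced_word :: "('a, 'm) monoid_scheme \<Rightarrow> 'a set \<Rightarrow> 'a list \<Rightarrow> bool" where
  "reduced_word G B w \<longleftrightarrow>
     set w \<subseteq> letters G B \<and> successively (\<lambda>a b. b \<noteq> inv\<^bsub>G\<^esub> a) w"

definition cyclically_reduced_word :: "('a, 'm) monoid_scheme \<Rightarrow> 'a set \<Rightarrow> 'a list \<Rightarrow> bool" where
  "cyclically_reduced_word G B w \<longleftrightarrow>
     reduced_word G B w \<and> (w \<noteq> [] \<longrightarrow> hd w \<noteq> inv\<^bsub>G\<^esub> (last w))"

definition free_basis :: "('a, 'm) monoid_scheme \<Rightarrow> 'a set \<Rightarrow> bool" where
  "free_basis G B \<longleftrightarrow>
     B \<subseteq> carrier G \<and>
     (\<forall>b\<in>B. inv\<^bsub>G\<^esub> b \<notin> B) \<and>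
     (\<forall>g\<in>carrier G. \<exists>!w. reduced_word G B w \<and> word_prod G w = g)"

definition free_group :: "('a, 'm) monoid_scheme \<Rightarrow> bool" where
  "free_group G \<longleftrightarrow> group G \<and> (\<exists>B. free_basis G B)"


section \<open>Free products and separable elements\<close>

definition conjugate_in :: "('a, 'm) monoid_scheme \<Rightarrow> 'a \<Rightarrow> 'a \<Rightarrow> bool" where
  "conjugate_in G x y \<longleftrightarrow> (\<exists>g\<in>carrier G. y = g \<otimes>\<^bsub>G\<^esub> x \<otimes>\<^bsub>G\<^esub> inv\<^bsub>G\<^esub> g)"

text \<open>
  \<open>G\<close> is the internal free product \<open>H * K\<close>, expressed by normal forms: every element is uniquely
  an alternating product of non-trivial elements of \<open>H\<close> and \<open>K\<close>. The condition \<open>H \<inter> K = {\<one>}\<close>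
  makes the factor to which a syllable belongs unambiguous.
\<close>

definition is_free_product ::
    "('a, 'm) monoid_scheme \<Rightarrow> 'a set \<Rightarrow> 'a set \<Rightarrow> bool" where
  "is_free_product G H K \<longleftrightarrow>
     subgroup H G \<and> subgroup K G \<and> H \<inter> K = {\<one>\<^bsub>G\<^esub>} \<and>
     (\<forall>g\<in>carrier G. \<exists>!w.
        set w \<subseteq> (H \<union> K) - {\<one>\<^bsub>G\<^esub>} \<and>
        successively (\<lambda>a b. (a \<in> H \<and> b \<in> K) \<or> (a \<in> K \<and> b \<in> H)) w \<and>
        word_prod G w = g)"

definition separable :: "('a, 'm) monoid_scheme \<Rightarrow> 'a \<Rightarrow> bool" where
  "separable G x \<longleftrightarrow>
     (\<exists>H K. is_free_product G H K \<and> H \<noteq> {\<one>\<^bsub>G\<^esub>} \<and> K \<noteq> {\<one>\<^bsub>G\<^esub>} \<and>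
        (\<exists>y \<in> H \<union> K. conjugate_in G x y))"


section \<open>Undirected connectivity\<close>

text \<open>
  An undirected multigraph is represented by a directed one with one arc, in an arbitrary
  direction, for each edge; directions are forgotten by \<open>mk_symmetric\<close>.

  \<open>Digraph_Component.connected\<close> demands a non-empty vertex set. Here the graph without
  vertices, which is the Whitehead graph of the trivial group, counts as connected.
\<close>

definition graph_connected :: "('v, 'e) pre_digraph \<Rightarrow> bool" where
  "graph_connected \<Gamma> \<longleftrightarrow> verts \<Gamma> = {} \<or> Digraph_Component.connected \<Gamma>"

definition graph_components :: "('v, 'e) pre_digraph \<Rightarrow> 'v set set" where
  "graph_components \<Gamma> = pre_digraph.sccs_verts (with_proj (mk_symmetric \<Gamma>))"

text \<open>
  The numbers of components are compared as cardinals (\<open>card\<close> would be \<open>0\<close> on infinite sets).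
\<close>

definition cut_vertex :: "('v, 'e) pre_digraph \<Rightarrow> 'v \<Rightarrow> bool" where
  "cut_vertex \<Gamma> v \<longleftrightarrow>
     v \<in> verts \<Gamma> \<and> graph_components \<Gamma> \<prec> graph_components (pre_digraph.del_vert \<Gamma> v)"


section \<open>Whitehead graphs\<close>

text \<open>
  The edge with index \<open>i\<close> joins the \<open>i\<close>-th letter of the word to the inverse of the cyclically
  following letter.
\<close>

definition whitehead_graph_word ::
    "('a, 'm) monoid_scheme \<Rightarrow> 'a set \<Rightarrow> 'a list \<Rightarrow> ('a, nat) pre_digraph" where
  "whitehead_graph_word G B w =
     \<lparr> verts = letters G B,
       arcs = {..<length w},
       tail = (\<lambda>i. w ! i),
       head = (\<lambda>i. inv\<^bsub>G\<^esub> (w ! (Suc i mod length w))) \<rparr>"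

text \<open>
  The cyclically reduced word is determined only up to cyclic permutation, which merely renumbers
  the edges of the Whitehead graph.
\<close>

definition cyclic_reduction :: "('a, 'm) monoid_scheme \<Rightarrow> 'a set \<Rightarrow> 'a \<Rightarrow> 'a list" where
  "cyclic_reduction G B x =
     (SOME w. cyclically_reduced_word G B w \<and> conjugate_in G x (word_prod G w))"

definition whitehead_graph ::
    "('a, 'm) monoid_scheme \<Rightarrow> 'a set \<Rightarrow> 'a \<Rightarrow> ('a, nat) pre_digraph" where
  "whitehead_graph G B x = whitehead_graph_word G B (cyclic_reduction G B x)"

end

theory Submission
  imports Defs
begin

text \<open>
  If \<open>F = H * K\<close> and \<open>x\<close> is conjugate into a factor, colour \<open>g \<in> F\<close> according to whether its normal
  form starts in \<open>H\<close>. For a basis \<open>B\<close> the colour changes along finitely many edges of the Cayley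
  tree, and both ends of every translate of the axis of \<open>x\<close> have the same colour. If the Whitehead
  graph is connected without cut vertex, then a downward induction on cones of the tree shows that
  the colour is constant up to finitely many exceptions: the branches at a vertex, apart from the one
  pointing back, are linked by axes since the Whitehead graph minus one vertex is connected. But
  both colours occur infinitely often.

  Conversely, choose \<open>B\<close> so that the cyclically reduced word of \<open>x\<close> is as short as possible. A cut
  vertex, or a component containing a letter of the word but not its inverse, yields a Whitehead
  automorphism which shortens the word. Otherwise the Whitehead graph is disconnected and some
  proper non-empty set of letters closed under inversion contains all or none of the letters of the
  word, so \<open>x\<close> is conjugate into a factor of the corresponding splitting of \<open>B\<close>.
\<close>

text \<open>The splitting determines the colour and the basis determines the tree; what connects
  them is right multiplication, which moves along edges of the tree and alters a normal form at its
  end, far from the first syllable. Both ends of an axis agree because the eventual colour of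
  \<open>g \<otimes> y [^] n\<close> depends on \<open>y\<close> only through whether
  \<open>y \<in> H\<close>, and \<open>inv y\<close> gives the same answer. Infinite rank is
  harmless: a word has finitely many letters, so a connected Whitehead graph forces the basis to be
  finite before the induction starts. In the converse an automorphism is applied to the basis and
  not to \<open>x\<close>, so the minimum is taken over all bases and all words for conjugates of
  the fixed \<open>x\<close>. The case of \<open>x = \<one>\<close> in an infinite cyclic group has
  to be excluded: the Whitehead graph consists of two isolated vertices, yet two non-trivial
  subgroups of such a group always intersect, so nothing is separable. In the trivial group nothing
  is separable either, in accordance with the convention that the empty graph is connected.\<close>

section \<open>Connectivity and cut vertices\<close>

text \<open>Serves \<open>cut_vertex\<close> in a connected graph: the components form a singleton
  there, and the comparison of cardinals turns into the existence of two different components after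
  the deletion.\<close>

lemma singleton_lesspoll_iff: "{a} \<prec> D \<longleftrightarrow> (\<exists>x\<in>D. \<exists>y\<in>D. x \<noteq> y)"
proof
  assume *: "{a} \<prec> D"
  then obtain x where x: "x \<in> D"
    using not_lesspoll_empty[of "{a}"] by (cases "D = {}") auto
  have "D \<noteq> {x}"
    using * singleton_eqpoll[of a x] by (auto simp: lesspoll_def)
  then obtain y where "y \<in> D" "y \<noteq> x" using x by auto
  with x show "\<exists>x\<in>D. \<exists>y\<in>D. x \<noteq> y" by metis
next
  assume "\<exists>x\<in>D. \<exists>y\<in>D. x \<noteq> y"
  then obtain x y where xy: "x \<in> D" "y \<in> D" "x \<noteq> y" by metis
  have "{a} \<lesssim> D"
    using singleton_lepoll[of a x D] xy(1) by (simp add: insert_absorb)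
  moreover have "\<not> D \<approx> {a}"
  proof
    assume "D \<approx> {a}"
    then obtain u where "D = {u}" using eqpoll_singleton_iff[of D a] by metis
    with xy show False by simp
  qed
  ultimately show "{a} \<prec> D"
    using eqpoll_sym[of "{a}" D] by (simp add: lesspoll_def) metis
qed

lemma symmetric_closure_reachable_cong:
  assumes "u \<rightarrow>\<^sup>*\<^bsub>with_proj (mk_symmetric \<Gamma>)\<^esub> v"
    and "\<And>e. e \<in> arcs \<Gamma> \<Longrightarrow> P (tail \<Gamma> e) = P (head \<Gamma> e)"
  shows "P u = P v"
  using assms(1) unfolding reachable_def
  by (induction rule: rtrancl_on_induct) (auto simp: parcs_mk_symmetric assms(2))

text \<open>Connectivity of Whitehead graphs is exploited in this form: a property is shown to be
  invariant along each edge, and paths need not be mentioned.\<close>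

lemma graph_connected_cong:
  assumes "graph_connected \<Gamma>" "u \<in> verts \<Gamma>" "v \<in> verts \<Gamma>"
    and "\<And>e. e \<in> arcs \<Gamma> \<Longrightarrow> P (tail \<Gamma> e) = P (head \<Gamma> e)"
  shows "P u = P v"
  using assms symmetric_closure_reachable_cong[of \<Gamma> u v P]
  by (auto simp: graph_connected_def Digraph_Component.connected_def strongly_connected_def)

context wf_digraph
begin

lemma reachable_mk_symmetric_sym:
  assumes "u \<rightarrow>\<^sup>*\<^bsub>with_proj (mk_symmetric G)\<^esub> v"
  shows "v \<rightarrow>\<^sup>*\<^bsub>with_proj (mk_symmetric G)\<^esub> u"
  using symmetric_mk_symmetric assms by (rule symmetric_reachable)

text \<open>The set is the component of a vertex that fails to reach some other vertex.\<close>

lemma not_graph_connected_closed_set: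
  assumes "\<not> graph_connected G"
  shows "\<exists>C\<subseteq>verts G. C \<noteq> {} \<and> C \<noteq> verts G \<and>
    (\<forall>e\<in>arcs G. tail G e \<in> C \<longleftrightarrow> head G e \<in> C)"
proof -
  interpret S: pair_wf_digraph "mk_symmetric G" ..
  let ?R = "\<lambda>u v. u \<rightarrow>\<^sup>*\<^bsub>with_proj (mk_symmetric G)\<^esub> v"
  obtain u v where uv: "u \<in> verts G" "v \<in> verts G" "\<not> ?R u v"
    using assms
    by (auto simp: graph_connected_def Digraph_Component.connected_def strongly_connected_def)
  let ?C = "{z \<in> verts G. ?R u z}"
  have "u \<in> ?C" "v \<notin> ?C" using uv by auto
  then have "?C \<subseteq> verts G" "?C \<noteq> {}" "?C \<noteq> verts G" using uv(2) by auto
  moreover have "tail G e \<in> ?C \<longleftrightarrow> head G e \<in> ?C" if e: "e \<in> arcs G" for e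
  proof -
    have "?R (tail G e) (head G e)"
      using e by (intro S.reachable_adjI) (auto simp: parcs_mk_symmetric)
    note * = this reachable_mk_symmetric_sym[OF this]
    have "?R u (tail G e) \<longleftrightarrow> ?R u (head G e)"
      using *[THEN S.reachable_trans[rotated]] by blast
    then show ?thesis using e by simp
  qed
  ultimately show ?thesis by blast
qed

text \<open>The graph without vertices has no components and satisfies the right-hand side
  vacuously, in agreement with \<open>graph_connected\<close>.\<close>

lemma graph_connected_iff_components:
  "graph_connected G \<longleftrightarrow> (\<forall>Y\<in>graph_components G. \<forall>Z\<in>graph_components G. Y = Z)"
proof -
  interpret S: pair_wf_digraph "mk_symmetric G" ..
  have comps: "graph_components G = S.scc_of ` verts G"
    by (simp add: graph_components_def S.sccs_verts_conv_scc_of)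
  have eq: "S.scc_of u = S.scc_of v \<longleftrightarrow> u \<rightarrow>\<^sup>*\<^bsub>with_proj (mk_symmetric G)\<^esub> v"
    if "u \<in> verts G" "v \<in> verts G" for u v
  proof
    assume "S.scc_of u = S.scc_of v"
    then show "u \<rightarrow>\<^sup>*\<^bsub>with_proj (mk_symmetric G)\<^esub> v"
      using S.in_scc_of_self[of v] that S.scc_of_def by auto
  next
    assume *: "u \<rightarrow>\<^sup>*\<^bsub>with_proj (mk_symmetric G)\<^esub> v"
    then have **: "v \<rightarrow>\<^sup>*\<^bsub>with_proj (mk_symmetric G)\<^esub> u"
      by (rule reachable_mk_symmetric_sym)
    show "S.scc_of u = S.scc_of v"
      unfolding S.scc_of_def
      using S.reachable_trans[OF *] S.reachable_trans[OF **]
        S.reachable_trans[OF _ *] S.reachable_trans[OF _ **] by auto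
  qed
  have "graph_connected G \<longleftrightarrow>
      (\<forall>u\<in>verts G. \<forall>v\<in>verts G. u \<rightarrow>\<^sup>*\<^bsub>with_proj (mk_symmetric G)\<^esub> v)"
    by (auto simp: graph_connected_def Digraph_Component.connected_def strongly_connected_def)
  also have "\<dots> \<longleftrightarrow> (\<forall>u\<in>verts G. \<forall>v\<in>verts G. S.scc_of u = S.scc_of v)"
    using eq by (intro ball_cong refl) metis
  also have "\<dots> \<longleftrightarrow> (\<forall>Y\<in>graph_components G. \<forall>Z\<in>graph_components G. Y = Z)"
    unfolding comps by simp
  finally show ?thesis .
qed

lemma graph_components_empty_iff: "graph_components G = {} \<longleftrightarrow> verts G = {}"
proof -
  interpret S: pair_wf_digraph "mk_symmetric G" ..
  show ?thesis by (simp add: graph_components_def S.sccs_verts_conv_scc_of)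
qed

text \<open>A connected graph with a vertex has exactly one component, so having more of them after
  the deletion means being disconnected. If \<open>v\<close> is the only vertex, the empty graph
  remains, and \<open>v\<close> is not a cut vertex.\<close>

lemma cut_vertex_iff:
  assumes "graph_connected G"
  shows "cut_vertex G v \<longleftrightarrow> v \<in> verts G \<and> \<not> graph_connected (del_vert v)"
proof (cases "v \<in> verts G")
  case True
  interpret D: wf_digraph "del_vert v" by (rule wf_digraph_del_vert)
  have "graph_components G \<noteq> {}"
    using True graph_components_empty_iff by auto
  then obtain V where V: "V \<in> graph_components G" by auto
  have "graph_components G = {V}"
  proof
    show "graph_components G \<subseteq> {V}"
    proof
      fix Y assume "Y \<in> graph_components G"
      with assms V have "Y = V"
        unfolding graph_connected_iff_components by metis
      then show "Y \<in> {V}" by simp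
    qed
  qed (use V in simp)
  then have "cut_vertex G v \<longleftrightarrow> {V} \<prec> graph_components (del_vert v)"
    using True by (simp add: cut_vertex_def)
  then show ?thesis
    unfolding D.graph_connected_iff_components singleton_lesspoll_iff using True by metis
qed (simp add: cut_vertex_def)

end

section \<open>Words over a free basis\<close>

context monoid
begin

lemma word_prod_Nil [simp]: "word_prod G [] = \<one>"
  and word_prod_Cons [simp]: "word_prod G (a # w) = a \<otimes> word_prod G w"
  by (simp_all add: word_prod_def)

lemma word_prod_closed [simp, intro]: "set w \<subseteq> carrier G \<Longrightarrow> word_prod G w \<in> carrier G"
  by (induction w) auto

lemma word_prod_append:
  "set u \<subseteq> carrier G \<Longrightarrow> set v \<subseteq> carrier G \<Longrightarrow>
     word_prod G (u @ v) = word_prod G u \<otimes> word_prod G v"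
  by (induction u) (auto simp: m_assoc)

lemma word_prod_concat_replicate:
  "set w \<subseteq> carrier G \<Longrightarrow> word_prod G (concat (replicate n w)) = word_prod G w [^] n"
proof (induction n)
  case (Suc n)
  then have "set (concat (replicate n w)) \<subseteq> carrier G" by auto
  with Suc show ?case
    using nat_pow_Suc2[of "word_prod G w" n] by (simp add: word_prod_append del: set_concat)
qed simp

lemma word_prod_filter_one:
  "set w \<subseteq> carrier G \<Longrightarrow> word_prod G (filter (\<lambda>a. a \<noteq> \<one>) w) = word_prod G w"
  by (induction w) auto

end

context group
begin

lemma mult_inv_cancel [simp]:
  assumes "g \<in> carrier G" "x \<in> carrier G"
  shows "inv g \<otimes> (g \<otimes> x) = x" "g \<otimes> (inv g \<otimes> x) = x"
  using assms by (simp_all flip: m_assoc)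

lemma inv_word_prod:
  "set w \<subseteq> carrier G \<Longrightarrow> inv (word_prod G w) = word_prod G (rev (map (m_inv G) w))"
proof (induction w)
  case (Cons a w)
  then have "set (rev (map (m_inv G) w)) \<subseteq> carrier G" by auto
  with Cons show ?case by (simp add: word_prod_append inv_mult_group del: set_rev set_map)
qed simp

lemma hom_word_prod:
  assumes "\<phi> \<in> hom G H" "group H" "set w \<subseteq> carrier G"
  shows "\<phi> (word_prod G w) = word_prod H (map \<phi> w)"
proof -
  interpret H: group H by fact
  interpret group_hom G H \<phi> by unfold_locales fact
  show ?thesis using assms(3) by (induction w) auto
qed

lemma conjugate_in_refl [simp]: "x \<in> carrier G \<Longrightarrow> conjugate_in G x x"
  by (auto simp: conjugate_in_def intro!: bexI[of _ \<one>])

lemma conjugate_in_sym: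
  assumes "conjugate_in G x y" "x \<in> carrier G"
  shows "conjugate_in G y x"
proof -
  obtain g where g: "g \<in> carrier G" "y = g \<otimes> x \<otimes> inv g"
    using assms by (auto simp: conjugate_in_def)
  with assms(2) have "inv g \<otimes> y \<otimes> inv (inv g) = x"
    by (simp add: m_assoc)
  with g show ?thesis unfolding conjugate_in_def by (metis inv_closed)
qed

lemma conjugate_in_trans:
  assumes "conjugate_in G x y" "conjugate_in G y z" "x \<in> carrier G"
  shows "conjugate_in G x z"
proof -
  obtain g h where "g \<in> carrier G" "y = g \<otimes> x \<otimes> inv g"
      "h \<in> carrier G" "z = h \<otimes> y \<otimes> inv h"
    using assms by (auto simp: conjugate_in_def)
  with assms(3) have "z = (h \<otimes> g) \<otimes> x \<otimes> inv (h \<otimes> g)"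
    by (simp add: m_assoc inv_mult_group)
  then show ?thesis
    using \<open>g \<in> carrier G\<close> \<open>h \<in> carrier G\<close> unfolding conjugate_in_def by blast
qed

lemma pow_conjugate:
  assumes "g \<in> carrier G" "x \<in> carrier G"
  shows "(g \<otimes> x \<otimes> inv g) [^] (n::nat) = g \<otimes> x [^] n \<otimes> inv g"
proof (induction n)
  case (Suc n)
  then have "(g \<otimes> x \<otimes> inv g) [^] Suc n = (g \<otimes> x [^] n) \<otimes> (inv g \<otimes> g) \<otimes> x \<otimes> inv g"
    using assms by (simp add: m_assoc)
  then show ?case using assms by (simp add: m_assoc)
qed (use assms in simp)

lemma word_prod_rotate_conjugate:
  assumes "set w \<subseteq> carrier G"
  shows "conjugate_in G (word_prod G w) (word_prod G (rotate n w))"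
proof -
  let ?u = "take (n mod length w) w" and ?v = "drop (n mod length w) w"
  have uv: "set ?u \<subseteq> carrier G" "set ?v \<subseteq> carrier G"
    using assms set_take_subset set_drop_subset by fast+
  have "word_prod G w = word_prod G ?u \<otimes> word_prod G ?v"
    using word_prod_append[OF uv] by simp
  moreover have "word_prod G (rotate n w) = word_prod G ?v \<otimes> word_prod G ?u"
    using word_prod_append[OF uv(2,1)] by (simp add: rotate_drop_take)
  ultimately have "word_prod G (rotate n w) =
      inv (word_prod G ?u) \<otimes> word_prod G w \<otimes> inv (inv (word_prod G ?u))"
    using uv by (simp flip: m_assoc)
  then show ?thesis
    using uv unfolding conjugate_in_def by (metis inv_closed word_prod_closed)
qed

end

lemma subset_image_map: "set w \<subseteq> f ` A \<Longrightarrow> \<exists>v. w = map f v \<and> set v \<subseteq> A"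
proof (induction w)
  case (Cons a w)
  then obtain b v where "a = f b" "b \<in> A" "w = map f v" "set v \<subseteq> A" by auto
  then show ?case by (intro exI[of _ "b # v"]) simp
qed simp

lemma not_successively_decomp:
  assumes "\<not> successively P u"
  shows "\<exists>p a b q. u = p @ a # b # q \<and> \<not> P a b"
  using assms
proof (induction P u rule: successively.induct)
  case (3 P x y xs)
  show ?case
  proof (cases "P x y")
    case True
    then obtain p a b q where "y # xs = p @ a # b # q" "\<not> P a b"
      using 3 by auto
    then have "x # y # xs = (x # p) @ a # b # q" "\<not> P a b" by simp_all
    then show ?thesis by blast
  next
    case False
    then have "x # y # xs = [] @ x # y # xs" "\<not> P x y" by simp_all
    then show ?thesis by blast
  qed
qed auto

section \<open>Reduced words over a fixed basis\<close>

locale based_free_group = group F for F (structure) +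
  fixes B :: "'a set"
  assumes basis: "free_basis F B"
begin

abbreviation L :: "'a set" where "L \<equiv> letters F B"
abbreviation red :: "'a list \<Rightarrow> bool" where "red \<equiv> reduced_word F B"
abbreviation cyc :: "'a list \<Rightarrow> bool" where "cyc \<equiv> cyclically_reduced_word F B"

lemma basis_subset: "B \<subseteq> carrier F"
  using basis by (simp add: free_basis_def)

lemma letters_subset: "L \<subseteq> carrier F"
  using basis_subset by (auto simp: letters_def)

lemma letter_closed [simp]: "l \<in> L \<Longrightarrow> l \<in> carrier F"
  using letters_subset by blast

lemma inv_letter [simp]: "l \<in> L \<Longrightarrow> inv l \<in> L"
  using basis_subset by (auto simp: letters_def)

lemma inv_letter_neq: "l \<in> L \<Longrightarrow> inv l \<noteq> l"
proof -
  assume "l \<in> L"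
  then consider "l \<in> B" | b where "b \<in> B" "l = inv b"
    by (auto simp: letters_def)
  then show ?thesis
  proof cases
    case 1
    then show ?thesis using basis by (metis free_basis_def)
  next
    case 2
    then show ?thesis using basis basis_subset by (metis free_basis_def inv_inv subsetD)
  qed
qed

lemma one_not_letter: "\<one> \<notin> L"
  using inv_letter_neq by force

lemma red_letters: "red w \<Longrightarrow> set w \<subseteq> L"
  by (simp add: reduced_word_def)

lemma letters_word_closed [simp]: "set w \<subseteq> L \<Longrightarrow> set w \<subseteq> carrier F"
  using letters_subset by blast

lemma red_closed [simp]: "red w \<Longrightarrow> set w \<subseteq> carrier F"
  using red_letters by simp

lemma red_Nil [simp]: "red []"
  by (simp add: reduced_word_def)

lemma red_Cons: "red (a # w) \<longleftrightarrow> a \<in> L \<and> red w \<and> (w \<noteq> [] \<longrightarrow> hd w \<noteq> inv a)"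
  by (auto simp: reduced_word_def successively_Cons)

lemma red_append:
  "red (u @ v) \<longleftrightarrow> red u \<and> red v \<and> (u \<noteq> [] \<and> v \<noteq> [] \<longrightarrow> hd v \<noteq> inv (last u))"
  by (auto simp: reduced_word_def successively_append_iff)

lemma word_prod_inj: "red u \<Longrightarrow> red v \<Longrightarrow> word_prod F u = word_prod F v \<Longrightarrow> u = v"
  using basis red_closed unfolding free_basis_def by (metis word_prod_closed)

lemma exists_reduced_word: "g \<in> carrier F \<Longrightarrow> \<exists>w. red w \<and> word_prod F w = g"
  using basis unfolding free_basis_def by metis

definition word_of :: "'a \<Rightarrow> 'a list" where
  "word_of g = (THE w. red w \<and> word_prod F w = g)"

lemma word_of_eq: "red w \<Longrightarrow> word_of (word_prod F w) = w"
  unfolding word_of_def using word_prod_inj by blast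

lemma red_word_of: "g \<in> carrier F \<Longrightarrow> red (word_of g)"
  and word_prod_word_of [simp]: "g \<in> carrier F \<Longrightarrow> word_prod F (word_of g) = g"
  using exists_reduced_word word_of_eq by metis+

lemma word_of_one [simp]: "word_of \<one> = []"
  using word_of_eq[of "[]"] by simp

lemma word_of_letter: "l \<in> L \<Longrightarrow> word_of l = [l]"
  using word_of_eq[of "[l]"] by (simp add: red_Cons)

text \<open>The action of a letter on reduced words. Since letters generate the group, this rule
  carries both the universal property in \<open>extend_hom\<close> and the description of spans in
  \<open>in_letter_span_iff\<close>.\<close>

lemma word_of_mult_letter:
  assumes "l \<in> L" "g \<in> carrier F"
  shows "word_of (l \<otimes> g) =
    (if word_of g \<noteq> [] \<and> hd (word_of g) = inv l then tl (word_of g) else l # word_of g)"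
proof (cases "word_of g \<noteq> [] \<and> hd (word_of g) = inv l")
  case True
  then obtain v where v: "word_of g = inv l # v" by (cases "word_of g") auto
  then have "red v" using red_word_of[OF assms(2)] by (simp add: red_Cons)
  moreover have "g = inv l \<otimes> word_prod F v"
    using word_prod_word_of[OF assms(2)] v by simp
  then have "l \<otimes> g = word_prod F v"
    using assms(1) \<open>red v\<close> by (simp flip: m_assoc)
  ultimately show ?thesis using v word_of_eq by simp
next
  case False
  then have "red (l # word_of g)" using red_word_of assms by (auto simp: red_Cons)
  then show ?thesis using False word_of_eq[of "l # word_of g"] assms by auto
qed

definition len :: "'a \<Rightarrow> nat" where "len g = length (word_of g)"

lemma len_word_prod: "red w \<Longrightarrow> len (word_prod F w) = length w"
  by (simp add: len_def word_of_eq)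

lemma len_word_prod_le: "set w \<subseteq> L \<Longrightarrow> len (word_prod F w) \<le> length w"
  by (induction w) (auto simp: len_def word_of_mult_letter intro: le_SucI)

lemma len_mult_le:
  assumes "g \<in> carrier F" "h \<in> carrier F"
  shows "len (g \<otimes> h) \<le> len g + len h"
proof -
  have "word_prod F (word_of g @ word_of h) = g \<otimes> h"
    using assms red_word_of by (simp add: word_prod_append)
  moreover have "set (word_of g @ word_of h) \<subseteq> L"
    using assms red_letters[OF red_word_of] by simp
  ultimately show ?thesis
    using len_word_prod_le[of "word_of g @ word_of h"] by (simp add: len_def)
qed

lemma len_pow_le: "g \<in> carrier F \<Longrightarrow> len (g [^] (n::nat)) \<le> n * len g"
proof (induction n)
  case (Suc n)
  then show ?case using len_mult_le[of "g [^] n" g] by simp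
qed (simp add: len_def)

section \<open>Cyclically reduced words\<close>

lemma cyc_red: "cyc w \<Longrightarrow> red w"
  by (simp add: cyclically_reduced_word_def)

lemma cyc_hd_last: "cyc w \<Longrightarrow> w \<noteq> [] \<Longrightarrow> hd w \<noteq> inv (last w)"
  by (simp add: cyclically_reduced_word_def)

lemma red_concat_replicate: "cyc w \<Longrightarrow> red (concat (replicate n w))"
proof (induction n)
  case (Suc n)
  have "hd (concat (replicate n w)) = hd w" if "concat (replicate n w) \<noteq> []"
    using that by (cases n) auto
  then show ?case
    using Suc cyc_red cyc_hd_last by (auto simp: red_append)
qed simp

lemma cyc_append_commute: "cyc (u @ v) \<Longrightarrow> cyc (v @ u)"
  by (cases "u = []"; cases "v = []") (auto simp: cyclically_reduced_word_def red_append)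

lemma cyc_rotate: "cyc w \<Longrightarrow> cyc (rotate n w)"
  using cyc_append_commute[of "take (n mod length w) w" "drop (n mod length w) w"]
  by (simp add: rotate_drop_take)

lemma red_hd_letter: "red w \<Longrightarrow> w \<noteq> [] \<Longrightarrow> hd w \<in> L"
  and red_last_letter: "red w \<Longrightarrow> w \<noteq> [] \<Longrightarrow> last w \<in> L"
  using red_letters by force+

lemma red_inverse: "red w \<Longrightarrow> red (rev (map (m_inv F) w))"
proof (induction w)
  case (Cons a w)
  then show ?case
    using red_hd_letter[of w] by (auto simp: red_Cons red_append last_rev hd_map)
qed simp

lemma cyc_inverse:
  assumes "cyc w"
  shows "cyc (rev (map (m_inv F) w))"
proof -
  have "hd (rev (map (m_inv F) w)) \<noteq> inv (last (rev (map (m_inv F) w)))" if "w \<noteq> []"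
    using that cyc_hd_last[OF assms] red_hd_letter[OF cyc_red[OF assms]]
    by (simp add: hd_rev last_rev last_map hd_map)
  then show ?thesis
    using red_inverse[OF cyc_red[OF assms]] by (auto simp: cyclically_reduced_word_def)
qed

lemma cyc_length_minimal:
  assumes "cyc w" "set u \<subseteq> L" "conjugate_in F (word_prod F u) (word_prod F w)"
  shows "length w \<le> length u"
  \<comment> \<open>Otherwise large powers of \<open>w\<close>, whose length grows by \<open>length w\<close> each time, would be longer than
    the conjugates of the corresponding powers of \<open>u\<close>.\<close>
proof (rule ccontr)
  assume less: "\<not> length w \<le> length u"
  obtain g where g: "g \<in> carrier F" "word_prod F w = g \<otimes> word_prod F u \<otimes> inv g"
    using assms by (auto simp: conjugate_in_def)
  \<comment> \<open>Exceeds the total error caused by the conjugating element, so that this error is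
    smaller than the \<open>n\<close> letters gained in the power.\<close>
  define n where "n = Suc (len g + len (inv g))"
  have u: "word_prod F u \<in> carrier F" using assms(2) by simp
  have "n * length w = len (word_prod F (concat (replicate n w)))"
    using red_concat_replicate[OF assms(1)]
    by (simp add: len_word_prod length_concat sum_list_replicate)
  also have "word_prod F (concat (replicate n w)) = g \<otimes> word_prod F u [^] n \<otimes> inv g"
    using cyc_red[OF assms(1)] g u
    by (simp add: word_prod_concat_replicate pow_conjugate)
  also have "len \<dots> \<le> len g + n * len (word_prod F u) + len (inv g)"
    using len_mult_le[of "g \<otimes> word_prod F u [^] n" "inv g"]
      len_mult_le[of g "word_prod F u [^] n"] len_pow_le[of "word_prod F u" n] g u by simp
  also have "\<dots> \<le> len g + n * length u + len (inv g)"
    using len_word_prod_le[OF assms(2)] by simp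
  also have "\<dots> < n * Suc (length u)" by (simp add: n_def)
  also have "\<dots> \<le> n * length w" using less by (intro mult_le_mono) auto
  finally show False by simp
qed

text \<open>A cancellation inside the word, or between its two ends after conjugation, would give a
  shorter word for a conjugate of \<open>x\<close>.\<close>

lemma minimal_imp_cyc:
  assumes w: "set w \<subseteq> L" "conjugate_in F x (word_prod F w)" and x: "x \<in> carrier F"
    and min: "\<And>v. set v \<subseteq> L \<Longrightarrow> conjugate_in F x (word_prod F v) \<Longrightarrow> length w \<le> length v"
  shows "cyc w"
proof -
  have "red w"
  proof (rule ccontr)
    assume "\<not> red w"
    then have "\<not> successively (\<lambda>a b. b \<noteq> inv a) w"
      using w by (simp add: reduced_word_def)
    then obtain p a b q where *: "w = p @ a # b # q" "\<not> b \<noteq> inv a"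
      using not_successively_decomp[of "\<lambda>a b. b \<noteq> inv a" w] by blast
    then have w_eq: "w = p @ a # inv a # q" by simp
    have "word_prod F w = word_prod F (p @ q)"
      using w(1) unfolding w_eq by (simp add: word_prod_append flip: m_assoc)
    then show False using min[of "p @ q"] w unfolding w_eq by auto
  qed
  moreover have "hd w \<noteq> inv (last w)" if nonempty: "w \<noteq> []"
  proof
    assume *: "hd w = inv (last w)"
    obtain a v where v: "w = a # v" using nonempty by (cases w) auto
    \<comment> \<open>A single letter is not its own inverse, so the two cancelling ends are
      different positions.\<close>
    with * w(1) inv_letter_neq[of a] have "v \<noteq> []" by auto
    then obtain m c where "v = m @ [c]" by (metis rev_exhaust)
    with * v have w_eq: "w = inv c # m @ [c]" by simp
    have c: "c \<in> L" "set m \<subseteq> L" using w(1) w_eq by auto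
    then have "word_prod F w = inv c \<otimes> word_prod F m \<otimes> inv (inv c)"
      unfolding w_eq by (simp add: word_prod_append m_assoc)
    then have "conjugate_in F (word_prod F m) (word_prod F w)"
      using c unfolding conjugate_in_def by (metis inv_closed letter_closed)
    then have "conjugate_in F x (word_prod F m)"
      using conjugate_in_trans[OF w(2) _ x] conjugate_in_sym c by simp
    then show False using min[of m] w unfolding w_eq by auto
  qed
  ultimately show ?thesis by (simp add: cyclically_reduced_word_def)
qed

lemma exists_cyc:
  assumes "x \<in> carrier F"
  shows "\<exists>w. cyc w \<and> conjugate_in F x (word_prod F w)"
proof -
  let ?P = "\<lambda>w. set w \<subseteq> L \<and> conjugate_in F x (word_prod F w)"
  have "?P (word_of x)" using assms red_letters[OF red_word_of] by simp
  then obtain w where "?P w" "\<And>v. ?P v \<Longrightarrow> length w \<le> length v"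
    using ex_has_least_nat[of ?P "word_of x" length] by auto
  then show ?thesis using minimal_imp_cyc[of w x] assms by auto
qed

lemma cyclic_reduction:
  assumes "x \<in> carrier F"
  shows "cyc (cyclic_reduction F B x)"
    "conjugate_in F x (word_prod F (cyclic_reduction F B x))"
  using someI_ex[OF exists_cyc[OF assms]] unfolding cyclic_reduction_def by auto

section \<open>The universal property of a basis, and images of a basis under automorphisms\<close>

lemma extend_hom:
  assumes "group H" "\<And>l. l \<in> L \<Longrightarrow> f l \<in> carrier H" "\<And>l. l \<in> L \<Longrightarrow> f (inv l) = inv\<^bsub>H\<^esub> f l"
  shows "\<exists>\<phi>\<in>hom F H. \<forall>l\<in>L. \<phi> l = f l"
proof
  interpret H: group H by fact
  define \<phi> where "\<phi> g = word_prod H (map f (word_of g))" for g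
  have closed: "set (map f w) \<subseteq> carrier H" if "set w \<subseteq> L" for w
    using that assms(2) by auto
  have \<phi>_closed: "\<phi> g \<in> carrier H" if "g \<in> carrier F" for g
    unfolding \<phi>_def using that closed red_letters[OF red_word_of] by blast
  have letter: "\<phi> (l \<otimes> g) = f l \<otimes>\<^bsub>H\<^esub> \<phi> g" if l: "l \<in> L" and g: "g \<in> carrier F" for l g
  proof (cases "word_of g \<noteq> [] \<and> hd (word_of g) = inv l")
    case True
    then obtain v where v: "word_of g = inv l # v" by (cases "word_of g") auto
    then have "set v \<subseteq> L" using red_letters[OF red_word_of[OF g]] by simp
    then have "word_prod H (map f v) \<in> carrier H" using closed by blast
    then show ?thesis
      using v l g assms(2,3) by (simp add: \<phi>_def word_of_mult_letter flip: H.m_assoc)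
  qed (use l g in \<open>auto simp: \<phi>_def word_of_mult_letter\<close>)
  \<comment> \<open>Multiplicativity for a left factor given as a word, so that its letters can be
    moved across one at a time by \<open>letter\<close>.\<close>
  have word: "\<phi> (word_prod F w \<otimes> g) = word_prod H (map f w) \<otimes>\<^bsub>H\<^esub> \<phi> g"
    if "set w \<subseteq> L" "g \<in> carrier F" for w g
    using that
  proof (induction w)
    case (Cons l w)
    then have "word_prod H (map f w) \<in> carrier H" using closed[of w] by auto
    with Cons show ?case using assms(2) \<phi>_closed by (simp add: m_assoc H.m_assoc letter)
  qed (simp add: \<phi>_closed)
  show "\<phi> \<in> hom F H"
  proof (rule homI)
    fix g h assume "g \<in> carrier F" "h \<in> carrier F"
    then show "\<phi> (g \<otimes> h) = \<phi> g \<otimes>\<^bsub>H\<^esub> \<phi> h"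
      using word[of "word_of g" h] red_letters[OF red_word_of] by (simp add: \<phi>_def[of g])
  qed (rule \<phi>_closed)
  show "\<forall>l\<in>L. \<phi> l = f l" using assms(2) by (simp add: \<phi>_def word_of_letter)
qed

lemma hom_identity:
  assumes "\<phi> \<in> hom F F" "\<And>l. l \<in> L \<Longrightarrow> \<phi> l = l" "g \<in> carrier F"
  shows "\<phi> g = g"
proof -
  have "map \<phi> (word_of g) = word_of g"
    using assms(2) red_letters[OF red_word_of[OF assms(3)]] by (intro map_idI) auto
  then show ?thesis
    using hom_word_prod[OF assms(1) is_group, of "word_of g"] assms(3) red_word_of by simp
qed

lemma letters_image:
  assumes "\<phi> \<in> hom F F"
  shows "letters F (\<phi> ` B) = \<phi> ` L"
proof -
  interpret group_hom F F \<phi> by unfold_locales (fact assms)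
  have "(\<lambda>b. inv \<phi> b) ` B = (\<lambda>b. \<phi> (inv b)) ` B"
    using basis_subset by (intro image_cong) auto
  then show ?thesis by (simp add: letters_def image_Un image_image)
qed

text \<open>An automorphism matches reduced words over \<open>B\<close> with those over the image,
  letter by letter and in both directions, so existence and uniqueness of spellings carry over. All
  new bases arise in this way.\<close>

lemma free_basis_image:
  assumes "\<phi> \<in> iso F F"
  shows "free_basis F (\<phi> ` B)"
proof -
  have hom: "\<phi> \<in> hom F F" and inj: "inj_on \<phi> (carrier F)" and surj: "\<phi> ` carrier F = carrier F"
    using assms by (auto simp: iso_def bij_betw_def)
  interpret group_hom F F \<phi> by unfold_locales (fact hom)
  note letters = letters_image[OF hom]
  have red: "reduced_word F (\<phi> ` B) (map \<phi> w) \<longleftrightarrow> red w" if w: "set w \<subseteq> carrier F" for w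
  proof -
    have "\<phi> b = inv \<phi> a \<longleftrightarrow> b = inv a" if "a \<in> carrier F" "b \<in> carrier F" for a b
      using that inj_on_eq_iff[OF inj, of b "inv a"] by simp
    then have succ:
      "successively (\<lambda>a b. \<phi> b \<noteq> inv \<phi> a) w \<longleftrightarrow> successively (\<lambda>a b. b \<noteq> inv a) w"
      using w by (intro successively_cong) auto
    have mem: "\<phi> l \<in> \<phi> ` L \<longleftrightarrow> l \<in> L" if "l \<in> set w" for l
      using inj_on_image_mem_iff[OF inj _ letters_subset] w that by blast
    have "\<phi> ` set w \<subseteq> \<phi> ` L \<longleftrightarrow> set w \<subseteq> L"
      unfolding image_subset_iff subset_eq using mem by simp
    with succ show ?thesis by (simp add: reduced_word_def letters successively_map)
  qed
  show ?thesis
    unfolding free_basis_def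
  proof (intro conjI ballI)
    show "\<phi> ` B \<subseteq> carrier F" using basis_subset by auto
    fix c assume "c \<in> \<phi> ` B"
    then obtain b where b: "b \<in> B" "c = \<phi> b" by blast
    then have "inv b \<notin> B" "b \<in> carrier F"
      using basis basis_subset by (auto simp: free_basis_def)
    then have "\<phi> (inv b) \<notin> \<phi> ` B"
      using inj_on_image_mem_iff[OF inj _ basis_subset, of "inv b"] by simp
    then show "inv c \<notin> \<phi> ` B" using b \<open>b \<in> carrier F\<close> by simp
  next
    fix g assume "g \<in> carrier F"
    then obtain h where h: "h \<in> carrier F" "g = \<phi> h" using surj by auto
    show "\<exists>!w. reduced_word F (\<phi> ` B) w \<and> word_prod F w = g"
    proof
      show "reduced_word F (\<phi> ` B) (map \<phi> (word_of h)) \<and> word_prod F (map \<phi> (word_of h)) = g"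
        using h red_word_of hom_word_prod[OF hom is_group, of "word_of h"] by (simp add: red)
    next
      fix w assume w: "reduced_word F (\<phi> ` B) w \<and> word_prod F w = g"
      then have "set w \<subseteq> \<phi> ` L" by (simp add: reduced_word_def letters)
      then obtain v where v: "w = map \<phi> v" "set v \<subseteq> L"
        using subset_image_map by blast
      have "\<phi> (word_prod F v) = \<phi> h"
        using w v h hom_word_prod[OF hom is_group, of v] by simp
      then have "word_prod F v = h" using inj v h by (simp add: inj_on_eq_iff)
      then show "w = map \<phi> (word_of h)"
        using word_of_eq[of v] red[of v] w v by simp
    qed
  qed
qed

end

section \<open>Normal forms in a free product\<close>

lemma (in group) inj_mult_nat_pow:
  assumes "inj (\<lambda>n::nat. y [^] n)" "g \<in> carrier G" "y \<in> carrier G"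
  shows "inj (\<lambda>n::nat. g \<otimes> y [^] n)"
  using assms by (auto simp: inj_def)

locale free_splitting = group F for F (structure) +
  fixes H K :: "'a set"
  assumes splitting: "is_free_product F H K"
begin

abbreviation alternating :: "'a list \<Rightarrow> bool" where
  "alternating w \<equiv> set w \<subseteq> (H \<union> K) - {\<one>} \<and>
     successively (\<lambda>a b. (a \<in> H \<and> b \<in> K) \<or> (a \<in> K \<and> b \<in> H)) w"

definition syllables :: "'a \<Rightarrow> 'a list" where
  "syllables g = (THE w. alternating w \<and> word_prod F w = g)"

text \<open>The colouring of the Cayley tree. The element \<open>\<one>\<close> has no syllables and
  receives the same colour as the elements starting in \<open>K\<close>; this asymmetry causes the
  exceptional elements below.\<close>

definition starts_in_H :: "'a \<Rightarrow> bool" where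
  "starts_in_H g \<longleftrightarrow> syllables g \<noteq> [] \<and> hd (syllables g) \<in> H"

lemma subgroup_H: "subgroup H F" and subgroup_K: "subgroup K F"
  and H_Int_K: "H \<inter> K = {\<one>}"
  using splitting by (simp_all add: is_free_product_def)

lemma factor_closed: "a \<in> H \<union> K \<Longrightarrow> a \<in> carrier F"
  using subgroup.subset[OF subgroup_H] subgroup.subset[OF subgroup_K] by auto

lemma alternating_closed: "alternating w \<Longrightarrow> set w \<subseteq> carrier F"
  using factor_closed by blast

lemma ex1_alternating: "g \<in> carrier F \<Longrightarrow> \<exists>!w. alternating w \<and> word_prod F w = g"
  using splitting by (simp add: is_free_product_def conj_assoc)

lemma alternating_syllables: "g \<in> carrier F \<Longrightarrow> alternating (syllables g)"
  and word_prod_syllables: "g \<in> carrier F \<Longrightarrow> word_prod F (syllables g) = g"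
  unfolding syllables_def using theI'[OF ex1_alternating] by blast+

lemma syllables_eq: "alternating w \<Longrightarrow> syllables (word_prod F w) = w"
  unfolding syllables_def using alternating_closed[of w]
  by (intro the1_equality[OF ex1_alternating]) auto

lemma syllables_one [simp]: "syllables \<one> = []"
  using syllables_eq[of "[]"] by simp

lemma starts_in_H_iff: "h \<in> H \<Longrightarrow> starts_in_H h \<longleftrightarrow> h \<noteq> \<one>"
  using syllables_eq[of "[h]"] factor_closed[of h]
  by (cases "h = \<one>") (auto simp: starts_in_H_def)

lemma not_starts_in_H: "k \<in> K \<Longrightarrow> \<not> starts_in_H k"
  using syllables_eq[of "[k]"] factor_closed[of k] H_Int_K
  by (cases "k = \<one>") (auto simp: starts_in_H_def)

text \<open>Multiplying by \<open>s\<close> on the right appends a syllable, or merges with the last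
  one, or cancels it. The first syllable is affected only if \<open>g\<close> is trivial or a single
  syllable from the factor of \<open>s\<close>, which \<open>g \<notin> S\<close> rules out. The
  names \<open>S\<close> and \<open>T\<close> allow one argument for both factors.\<close>

lemma starts_in_H_mult:
  assumes ST: "S = H \<and> T = K \<or> S = K \<and> T = H"
    and g: "g \<in> carrier F" "g \<notin> S" and s: "s \<in> S"
  shows "starts_in_H (g \<otimes> s) \<longleftrightarrow> starts_in_H g"
proof (cases "s = \<one>")
  case True
  then show ?thesis using g by simp
next
  case False
  define alt where "alt = (\<lambda>a b. (a \<in> S \<and> b \<in> T) \<or> (a \<in> T \<and> b \<in> S))"
  have alternating_alt:
    "alternating w \<longleftrightarrow> set w \<subseteq> (S \<union> T) - {\<one>} \<and> successively alt w" for w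
    using ST by (elim disjE conjE) (simp_all add: alt_def disj_commute Un_commute conj_commute)
  have sub: "subgroup S F" and "S \<inter> T = {\<one>}"
    using ST subgroup_H subgroup_K H_Int_K by auto
  then have not_T: "a \<notin> T" if "a \<in> S" "a \<noteq> \<one>" for a using that by blast
  have S_closed: "a \<in> S \<Longrightarrow> a \<in> carrier F" for a using subgroup.subset[OF sub] by blast
  let ?w = "syllables g"
  have w: "alternating ?w" "word_prod F ?w = g"
    using g alternating_syllables word_prod_syllables by auto
  have "?w \<noteq> []" using w g(2) subgroup.one_closed[OF sub] by auto
  then obtain p c where pc: "?w = p @ [c]" by (metis rev_exhaust)
  have p: "alternating p" "set p \<subseteq> carrier F" and c: "c \<in> S \<union> T" "c \<noteq> \<one>"
    and alt_pc: "p \<noteq> [] \<Longrightarrow> alt (last p) c"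
    using w(1) alternating_closed[OF w(1)] ST unfolding pc alternating_alt
    by (auto simp: successively_append_iff)
  have c_closed: "c \<in> carrier F" using w(1) alternating_closed[OF w(1)] pc by auto
  have g_eq: "g = word_prod F p \<otimes> c"
    using w(2) p c_closed unfolding pc by (simp add: word_prod_append)
  obtain v where v: "alternating v" "word_prod F v = g \<otimes> s" "v \<noteq> []" "hd v = hd ?w"
  proof (cases "c \<in> S")
    case True
    \<comment> \<open>Otherwise \<open>g\<close> would equal its only syllable \<open>c\<close>,
      which lies in \<open>S\<close>.\<close>
    have "p \<noteq> []" using True g(2) c_closed unfolding g_eq by auto
    have gs: "g \<otimes> s = word_prod F p \<otimes> (c \<otimes> s)"
      using g_eq p c_closed S_closed[OF s] by (simp add: m_assoc)
    show ?thesis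
    proof (cases "c \<otimes> s = \<one>")
      case True
      then show ?thesis using that[of p] p gs \<open>p \<noteq> []\<close> pc by simp
    next
      case False
      have cs: "c \<otimes> s \<in> S" using subgroup.m_closed[OF sub True s] .
      have "alternating (p @ [c \<otimes> s])"
        using p(1) cs False alt_pc not_T[OF True c(2)] unfolding alternating_alt
        by (auto simp: successively_append_iff alt_def)
      then show ?thesis
        using that[of "p @ [c \<otimes> s]"] p gs \<open>p \<noteq> []\<close> pc S_closed[OF cs]
        by (simp add: word_prod_append)
    qed
  next
    case c_T: False
    have "alternating (?w @ [s])"
      using w(1) s False c c_T unfolding alternating_alt
      by (auto simp: pc successively_append_iff alt_def)
    then show ?thesis
      using that[of "?w @ [s]"] w alternating_closed[OF w(1)] S_closed[OF s] \<open>?w \<noteq> []\<close>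
      by (simp add: word_prod_append)
  qed
  have "syllables (g \<otimes> s) = v" using syllables_eq[OF v(1)] v(2) by simp
  with v \<open>?w \<noteq> []\<close> show ?thesis by (simp add: starts_in_H_def)
qed

lemma starts_in_H_mult_H:
  "g \<in> carrier F \<Longrightarrow> g \<notin> H \<Longrightarrow> h \<in> H \<Longrightarrow> starts_in_H (g \<otimes> h) \<longleftrightarrow> starts_in_H g"
  using starts_in_H_mult[of H K] by simp

lemma starts_in_H_mult_K:
  assumes "g \<in> carrier F" "k \<in> K"
  shows "starts_in_H (g \<otimes> k) \<longleftrightarrow> starts_in_H g"
proof (cases "g \<in> K")
  case True
  then show ?thesis
    using assms not_starts_in_H subgroup.m_closed[OF subgroup_K] by simp
qed (use assms starts_in_H_mult[of K H] in simp)

text \<open>A change of colour at \<open>g\<close> along \<open>a # w\<close> happens either under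
  \<open>a\<close>, which leaves only \<open>\<one>\<close> and \<open>inv a\<close> for
  \<open>g\<close>, or under \<open>w\<close> at \<open>g \<otimes> a\<close>. The latter elements
  form a translate of the finite set belonging to \<open>w\<close>.\<close>

lemma finite_coboundary_word:
  "set w \<subseteq> H \<union> K \<Longrightarrow>
     finite {g \<in> carrier F. starts_in_H g \<noteq> starts_in_H (g \<otimes> word_prod F w)}"
proof (induction w)
  case (Cons a w)
  have a: "a \<in> H \<union> K" "a \<in> carrier F" and w: "word_prod F w \<in> carrier F"
    using Cons.prems factor_closed by (auto intro!: word_prod_closed)
  let ?E = "{g \<in> carrier F. starts_in_H g \<noteq> starts_in_H (g \<otimes> word_prod F w)}"
  have "starts_in_H g = starts_in_H (g \<otimes> a)" if "g \<in> carrier F" "g \<notin> {\<one>, inv a}" for g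
  proof (cases "g \<in> H \<and> a \<in> H")
    case True
    moreover from this have "g \<otimes> a \<in> H" using subgroup.m_closed[OF subgroup_H] by simp
    moreover have "g \<otimes> a \<noteq> \<one>" using that a inv_equality inv_inv by (metis insertCI inv_equality)
    ultimately show ?thesis using that by (simp add: starts_in_H_iff)
  next
    case False
    then show ?thesis using that a starts_in_H_mult_H starts_in_H_mult_K by auto
  qed
  then have "{g \<in> carrier F. starts_in_H g \<noteq> starts_in_H (g \<otimes> word_prod F (a # w))}
      \<subseteq> {\<one>, inv a} \<union> (\<lambda>g. g \<otimes> inv a) ` ?E"
  proof (intro subsetI)
    fix g assume *: "g \<in> {g \<in> carrier F. starts_in_H g \<noteq> starts_in_H (g \<otimes> word_prod F (a # w))}"
      and eq: "\<And>g. g \<in> carrier F \<Longrightarrow> g \<notin> {\<one>, inv a} \<Longrightarrow> starts_in_H g = starts_in_H (g \<otimes> a)"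
    show "g \<in> {\<one>, inv a} \<union> (\<lambda>g. g \<otimes> inv a) ` ?E"
    proof (cases "g \<in> {\<one>, inv a}")
      case False
      with * eq[of g] a w have "g \<otimes> a \<in> ?E" by (simp add: m_assoc)
      moreover have "g = g \<otimes> a \<otimes> inv a" using * a by (simp add: m_assoc)
      ultimately show ?thesis by blast
    qed blast
  qed
  moreover have "finite ?E" using Cons by simp
  ultimately show ?case
    by (meson finite.emptyI finite.insertI finite_UnI finite_imageI finite_subset)
qed (simp cong: conj_cong)

text \<open>Each colour class is thus almost invariant under right multiplication.\<close>

lemma finite_coboundary:
  assumes "f \<in> carrier F"
  shows "finite {g \<in> carrier F. starts_in_H g \<noteq> starts_in_H (g \<otimes> f)}"
  using finite_coboundary_word[of "syllables f"] alternating_syllables[OF assms]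
    word_prod_syllables[OF assms] by auto

text \<open>The elements \<open>g \<otimes> y [^] n\<close> stay in one coset of the factor
  containing \<open>y\<close>, where the colour is constant up to \<open>\<one>\<close>; the factor
  \<open>f\<close> adds finitely many exceptions. The first disjunct gives the correct value for
  \<open>g = \<one>\<close>. Injectivity turns finitely many exceptional elements into finitely many
  exponents.\<close>

lemma starts_in_H_pow:
  assumes y: "y \<in> H \<union> K" and inj: "inj (\<lambda>n::nat. y [^] n)"
    and g: "g \<in> carrier F" and f: "f \<in> carrier F"
  shows "finite {n::nat. starts_in_H (g \<otimes> y [^] n \<otimes> f) \<noteq> (y \<in> H \<and> g \<in> H \<or> starts_in_H g)}"
    (is "finite {n. _ n \<noteq> ?d}")
proof -
  have y_closed: "y \<in> carrier F" using y factor_closed by blast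
  have inj': "inj (\<lambda>n::nat. g \<otimes> y [^] n)" using inj_mult_nat_pow inj g y_closed .
  have pow: "y [^] n \<in> S" if "subgroup S F" "y \<in> S" for S and n :: nat
    using that by (induction n) (auto intro: subgroup.one_closed subgroup.m_closed)
  let ?E = "{h \<in> carrier F. starts_in_H h \<noteq> starts_in_H (h \<otimes> f)}"
  have "starts_in_H (g \<otimes> y [^] n) \<longleftrightarrow> ?d" if "g \<otimes> y [^] n \<noteq> \<one>" for n :: nat
  proof (cases "y \<in> H")
    case True
    then have n: "y [^] n \<in> H" using pow subgroup_H by blast
    show ?thesis
    proof (cases "g \<in> H")
      case True
      then have "g \<otimes> y [^] n \<in> H" using n subgroup.m_closed[OF subgroup_H] by blast
      then show ?thesis using that True \<open>y \<in> H\<close> by (simp add: starts_in_H_iff)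
    qed (use n g starts_in_H_mult_H in simp)
  next
    case False
    then have "y [^] n \<in> K" using pow subgroup_K y by blast
    then show ?thesis using starts_in_H_mult_K g False by simp
  qed
  then have "{n. starts_in_H (g \<otimes> y [^] n \<otimes> f) \<noteq> ?d}
      \<subseteq> (\<lambda>n::nat. g \<otimes> y [^] n) -` (?E \<union> {\<one>})"
    using g y_closed by auto
  moreover have "finite ((\<lambda>n::nat. g \<otimes> y [^] n) -` (?E \<union> {\<one>}))"
    using finite_coboundary[OF f] inj' by (intro finite_vimageI) auto
  ultimately show ?thesis by (rule finite_subset)
qed

text \<open>The witnesses are the positive powers of \<open>a \<otimes> b\<close>, told apart by the
  lengths of their normal forms \<open>[a, b, a, b, ...]\<close>. The power zero is left out because
  its normal form is empty.\<close>

lemma infinite_alternating_products: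
  assumes "a \<in> (H \<union> K) - {\<one>}" "b \<in> (H \<union> K) - {\<one>}" "a \<in> H \<longleftrightarrow> b \<in> K" "a \<in> K \<longleftrightarrow> b \<in> H"
  shows "infinite {g \<in> carrier F. syllables g \<noteq> [] \<and> hd (syllables g) = a}"
proof -
  define w where "w n = concat (replicate n [a, b])" for n
  have hd_w: "w n \<noteq> [] \<Longrightarrow> hd (w n) = a" for n unfolding w_def by (cases n) auto
  have nonempty: "w (Suc n) \<noteq> []" for n by (simp add: w_def)
  have alt: "alternating (w n)" for n
  proof (induction n)
    case (Suc n)
    moreover have "w (Suc n) = [a, b] @ w n" by (simp add: w_def)
    ultimately show ?case using assms hd_w[of n] by (auto simp: successively_Cons)
  qed (simp add: w_def)
  have "length (w n) = 2 * n" for n by (induction n) (auto simp: w_def)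
  then have "inj (\<lambda>n. word_prod F (w (Suc n)))"
    using syllables_eq[OF alt] by (intro injI) (metis Suc_inject mult_cancel1 numeral_2_eq_2 nat.simps(3))
  then have "infinite (range (\<lambda>n. word_prod F (w (Suc n))))"
    by (simp add: range_inj_infinite)
  moreover have "range (\<lambda>n. word_prod F (w (Suc n)))
      \<subseteq> {g \<in> carrier F. syllables g \<noteq> [] \<and> hd (syllables g) = a}"
    using nonempty syllables_eq[OF alt] hd_w[OF nonempty]
      word_prod_closed[OF alternating_closed[OF alt]] by auto
  ultimately show ?thesis using finite_subset by blast
qed

lemma infinite_sides:
  assumes "H \<noteq> {\<one>}" "K \<noteq> {\<one>}"
  shows "infinite {g \<in> carrier F. starts_in_H g \<noteq> d}"
proof -
  obtain h k where hk: "h \<in> H" "h \<noteq> \<one>" "k \<in> K" "k \<noteq> \<one>"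
    using assms subgroup.one_closed[OF subgroup_H] subgroup.one_closed[OF subgroup_K] by blast
  then have not: "h \<notin> K" "k \<notin> H" using H_Int_K by auto
  have "{g \<in> carrier F. syllables g \<noteq> [] \<and> hd (syllables g) = (if d then k else h)}
      \<subseteq> {g \<in> carrier F. starts_in_H g \<noteq> d}"
    using hk not by (auto simp: starts_in_H_def)
  moreover have
    "infinite {g \<in> carrier F. syllables g \<noteq> [] \<and> hd (syllables g) = (if d then k else h)}"
    using hk not infinite_alternating_products[of h k] infinite_alternating_products[of k h] by auto
  ultimately show ?thesis using finite_subset by blast
qed

end

section \<open>Cones in the Cayley tree\<close>

context based_free_group
begin

lemma wf_digraph_whitehead: "set w \<subseteq> L \<Longrightarrow> wf_digraph (whitehead_graph_word F B w)"
proof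
  fix i assume w: "set w \<subseteq> L" and "i \<in> arcs (whitehead_graph_word F B w)"
  then have i: "i < length w" "Suc i mod length w < length w"
    by (auto simp: whitehead_graph_word_def intro: mod_less_divisor)
  note nth_mem[OF i(1)] nth_mem[OF i(2)]
  with w show "tail (whitehead_graph_word F B w) i \<in> verts (whitehead_graph_word F B w)"
    "head (whitehead_graph_word F B w) i \<in> verts (whitehead_graph_word F B w)"
    by (auto simp: whitehead_graph_word_def)
qed

text \<open>Deals simultaneously with the full graph and with one vertex deleted: the root of the
  Cayley tree has no branch pointing back, any other vertex has exactly one.\<close>

lemma whitehead_edge_cong:
  assumes conn: "graph_connected (whitehead_graph_word F B w)"
    and cut: "\<And>v. \<not> cut_vertex (whitehead_graph_word F B w) v"
    and w: "set w \<subseteq> L" and V: "V = L \<or> (\<exists>a. V = L - {a})"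
    and P: "\<And>i. i < length w \<Longrightarrow> w ! i \<in> V \<Longrightarrow> inv (w ! (Suc i mod length w)) \<in> V \<Longrightarrow>
      P (w ! i) = P (inv (w ! (Suc i mod length w)))"
    and p: "p \<in> V" and q: "q \<in> V"
  shows "P p = P q"
proof -
  let ?W = "whitehead_graph_word F B w"
  interpret W: wf_digraph ?W by (rule wf_digraph_whitehead[OF w])
  show ?thesis
  proof (cases "V = L")
    case True
    show ?thesis
    proof (rule graph_connected_cong[OF conn])
      fix e assume "e \<in> arcs ?W"
      then show "P (tail ?W e) = P (head ?W e)"
        using P[of e] True W.tail_in_verts[of e] W.head_in_verts[of e]
        by (simp add: whitehead_graph_word_def)
    qed (use p q True in \<open>simp_all add: whitehead_graph_word_def\<close>)
  next
    case False
    with V obtain a where a: "V = L - {a}" "a \<in> L" by auto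
    have "graph_connected (W.del_vert a)"
      using cut[of a] a W.cut_vertex_iff[OF conn] by (simp add: whitehead_graph_word_def)
    then show ?thesis
    proof (rule graph_connected_cong)
      fix e assume "e \<in> arcs (W.del_vert a)"
      then have "e \<in> arcs ?W" "tail ?W e \<noteq> a" "head ?W e \<noteq> a"
        by (auto simp: W.arcs_del_vert)
      then show "P (tail (W.del_vert a) e) = P (head (W.del_vert a) e)"
        using P[of e] a W.tail_in_verts[of e] W.head_in_verts[of e]
        unfolding W.tail_del_vert W.head_del_vert by (simp add: whitehead_graph_word_def)
    qed (use p q a in \<open>unfold W.verts_del_vert, simp_all add: whitehead_graph_word_def\<close>)
  qed
qed

text \<open>If neither \<open>l\<close> nor its inverse occurs in \<open>w\<close>, then
  \<open>l\<close> is an isolated vertex, which connectivity forbids because \<open>inv l\<close> is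
  another vertex. So the finitely many letters of \<open>w\<close> and their inverses exhaust
  \<open>L\<close>.\<close>

lemma finite_letters:
  assumes "graph_connected (whitehead_graph_word F B w)" "set w \<subseteq> L"
  shows "finite L" "L \<noteq> {} \<Longrightarrow> w \<noteq> []"
proof -
  have sub: "L \<subseteq> set w \<union> m_inv F ` set w"
  proof
    fix l assume l: "l \<in> L"
    show "l \<in> set w \<union> m_inv F ` set w"
    proof (rule ccontr)
      assume *: "l \<notin> set w \<union> m_inv F ` set w"
      have "(l = l) = (inv l = l)"
        using assms(1)
      proof (rule graph_connected_cong)
        fix e assume "e \<in> arcs (whitehead_graph_word F B w)"
        then have e: "e < length w" "Suc e mod length w < length w"
          by (auto simp: whitehead_graph_word_def intro: mod_less_divisor)
        note nth_mem[OF e(1)] nth_mem[OF e(2)]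
        with * have "w ! e \<noteq> l" "inv (w ! (Suc e mod length w)) \<noteq> l" by blast+
        then show "(tail (whitehead_graph_word F B w) e = l) =
            (head (whitehead_graph_word F B w) e = l)"
          by (simp add: whitehead_graph_word_def)
      qed (use l in \<open>simp_all add: whitehead_graph_word_def\<close>)
      then show False using inv_letter_neq[OF l] by simp
    qed
  qed
  then show "finite L" using finite_subset by blast
  show "L \<noteq> {} \<Longrightarrow> w \<noteq> []" using sub by auto
qed

text \<open>The reduced words extending \<open>u\<close> are the vertices of the Cayley tree behind \<open>u\<close>.\<close>

definition eventually_on_cone :: "('a \<Rightarrow> bool) \<Rightarrow> 'a list \<Rightarrow> bool \<Rightarrow> bool" where
  "eventually_on_cone c u d \<longleftrightarrow> finite {t. red (u @ t) \<and> c (word_prod F (u @ t)) \<noteq> d}"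

text \<open>The ray through the vertices \<open>u v v ... v\<close> enters the cone behind
  \<open>u @ [hd v]\<close> and remains in it, so the eventual colours of the ray and of the cone
  are both attained at a common vertex.\<close>

lemma eventually_on_cone_ray:
  assumes good: "eventually_on_cone c (u @ [hd v]) d" and red: "red (u @ [hd v])"
    and v: "cyc v" "v \<noteq> []"
    and ray: "finite {n::nat. c (word_prod F u \<otimes> word_prod F v [^] n) \<noteq> d'}"
  shows "d = d'"
proof -
  \<comment> \<open>The first letter of \<open>v\<close> already belongs to the base of the cone, so
    \<open>t n\<close> leads to the vertex with \<open>Suc n\<close> copies of
    \<open>v\<close>.\<close>
  define t where "t n = tl v @ concat (replicate n v)" for n
  have u: "red u" using red by (simp add: red_append)
  have eq: "(u @ [hd v]) @ t n = u @ concat (replicate (Suc n) v)" for n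
    using v(2) by (simp add: t_def)
  have red_t: "red ((u @ [hd v]) @ t n)" for n
    unfolding eq using red red_concat_replicate[OF v(1), of "Suc n"] v(2) by (auto simp: red_append)
  have prod_t: "word_prod F ((u @ [hd v]) @ t n) = word_prod F u \<otimes> word_prod F v [^] Suc n" for n
    unfolding eq using u cyc_red[OF v(1)] red_concat_replicate[OF v(1), of "Suc n"]
    by (subst word_prod_append) (auto simp del: replicate_Suc nat_pow_Suc simp: word_prod_concat_replicate)
  have "length (t n) = length (tl v) + n * length v" for n
    by (induction n) (auto simp: t_def)
  then have "inj t" using v(2) by (intro injI) (metis add_left_cancel length_0_conv mult_cancel2)
  then have "finite (t -` {x. red ((u @ [hd v]) @ x) \<and> c (word_prod F ((u @ [hd v]) @ x)) \<noteq> d})"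
    using good by (intro finite_vimageI) (auto simp: eventually_on_cone_def)
  moreover have "finite (Suc -` {n. c (word_prod F u \<otimes> word_prod F v [^] n) \<noteq> d'})"
    using ray by (intro finite_vimageI) auto
  ultimately have "finite (t -` {x. red ((u @ [hd v]) @ x) \<and> c (word_prod F ((u @ [hd v]) @ x)) \<noteq> d}
      \<union> Suc -` {n. c (word_prod F u \<otimes> word_prod F v [^] n) \<noteq> d'})"
    by blast
  then obtain n where "n \<notin> t -` {x. red ((u @ [hd v]) @ x) \<and> c (word_prod F ((u @ [hd v]) @ x)) \<noteq> d}
      \<union> Suc -` {n. c (word_prod F u \<otimes> word_prod F v [^] n) \<noteq> d'}"
    using ex_new_if_finite infinite_UNIV_nat by blast
  then have "c (word_prod F ((u @ [hd v]) @ t n)) = d"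
    "c (word_prod F u \<otimes> word_prod F v [^] Suc n) = d'"
    using red_t[of n] by auto
  then show "d = d'" by (simp only: prod_t)
qed

text \<open>Edge \<open>i\<close> of the Whitehead graph is read off at the seam of this rotation:
  its tail is the last letter, its head the inverse of the first.\<close>

lemma rotate_Suc_hd_last:
  assumes "i < length w"
  shows "hd (rotate (Suc i) w) = w ! (Suc i mod length w)" "last (rotate (Suc i) w) = w ! i"
proof -
  have ne: "w \<noteq> []" using assms by auto
  then show "hd (rotate (Suc i) w) = w ! (Suc i mod length w)" by (rule hd_rotate_conv_nth)
  have "last (rotate (Suc i) w) = w ! ((Suc i + (length w - 1)) mod length w)"
    using ne by (subst last_conv_nth) (auto simp: nth_rotate simp del: rotate_Suc)
  also have "Suc i + (length w - 1) = i + length w" using assms by simp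
  finally show "last (rotate (Suc i) w) = w ! i" using assms by simp
qed

text \<open>An edge of the Whitehead graph is realised at every vertex \<open>u\<close> of the Cayley tree by a
  translate of the axis of \<open>w\<close> through \<open>u\<close>, whose two ends have the same colour.\<close>

lemma cone_step:
  assumes conn: "graph_connected (whitehead_graph_word F B w)"
    and cut: "\<And>v. \<not> cut_vertex (whitehead_graph_word F B w) v"
    and w: "cyc w"
    and axis: "\<And>g i. g \<in> carrier F \<Longrightarrow>
      \<exists>d. finite {n::nat. c (g \<otimes> word_prod F (rotate i w) [^] n) \<noteq> d} \<and>
          finite {n::nat. c (g \<otimes> inv (word_prod F (rotate i w)) [^] n) \<noteq> d}"
    and u: "red u" and good: "\<And>l. red (u @ [l]) \<Longrightarrow> \<exists>d. eventually_on_cone c (u @ [l]) d"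
  shows "\<exists>d. eventually_on_cone c u d"
proof -
  define D where "D l = (SOME d. eventually_on_cone c (u @ [l]) d)" for l
  have D: "eventually_on_cone c (u @ [l]) (D l)" if "red (u @ [l])" for l
    unfolding D_def using good[OF that] by (rule someI_ex)
  \<comment> \<open>A vertex \<open>q\<close> of the Whitehead graph stands for the branch
    \<open>inv q\<close> at \<open>u\<close>. The vertex \<open>last u\<close> is the branch
    pointing back to the root and is the one to be deleted.\<close>
  define V where "V = {q \<in> L. u \<noteq> [] \<longrightarrow> q \<noteq> last u}"
  have V: "V = L \<or> (\<exists>a. V = L - {a})" by (cases "u = []") (auto simp: V_def)
  have red_V: "red (u @ [inv q])" if "q \<in> V" for q
    using that u red_last_letter[of u] unfolding V_def by (auto simp: red_append red_Cons)
  have edge: "D (inv (w ! i)) = D (inv (inv (w ! (Suc i mod length w))))"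
    if i: "i < length w" and V: "w ! i \<in> V" "inv (w ! (Suc i mod length w)) \<in> V" for i
  proof -
    define v where "v = rotate (Suc i) w"
    have v: "cyc v" "v \<noteq> []" using w i by (auto simp: v_def cyc_rotate simp del: rotate_Suc)
    have hd_last: "hd v = w ! (Suc i mod length w)" "last v = w ! i"
      unfolding v_def using rotate_Suc_hd_last[OF i] by auto
    \<comment> \<open>The axis leaves \<open>u\<close> forwards along \<open>hd v\<close> and
      backwards along \<open>hd v'\<close>; these are the two branches joined by edge
      \<open>i\<close>.\<close>
    define v' where "v' = rev (map (m_inv F) v)"
    have v': "cyc v'" "v' \<noteq> []" "hd v' = inv (w ! i)"
      using v cyc_inverse[of v] hd_last by (auto simp: v'_def hd_rev last_map)
    have prod_v': "word_prod F v' = inv (word_prod F v)"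
      unfolding v'_def using inv_word_prod[OF red_closed[OF cyc_red[OF v(1)]]] by simp
    have "hd v \<in> L" using red_hd_letter[OF cyc_red[OF v(1)] v(2)] .
    then have eq: "inv (inv (w ! (Suc i mod length w))) = hd v"
      using hd_last by simp
    obtain d where d: "finite {n::nat. c (word_prod F u \<otimes> word_prod F v [^] n) \<noteq> d}"
      "finite {n::nat. c (word_prod F u \<otimes> word_prod F v' [^] n) \<noteq> d}"
      using axis[of "word_prod F u" "Suc i"] u unfolding v_def[symmetric] prod_v' by auto
    have "D (hd v) = d"
      using eventually_on_cone_ray[OF D _ v d(1)] red_V[OF V(2)] eq by simp
    moreover have "D (hd v') = d"
      using eventually_on_cone_ray[OF D _ v'(1,2) d(2)] red_V[OF V(1)] v'(3) by simp
    ultimately show ?thesis using v'(3) eq by simp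
  qed
  have const: "D (inv p) = D (inv q)" if "p \<in> V" "q \<in> V" for p q
    using whitehead_edge_cong[OF conn cut red_letters[OF cyc_red[OF w]] V, of "\<lambda>q. D (inv q)" p q]
      edge that by auto
  obtain d where d: "\<And>l. red (u @ [l]) \<Longrightarrow> D l = d"
  proof -
    have V_red: "inv l \<in> V \<and> inv (inv l) = l" if "red (u @ [l])" for l
    proof -
      have l: "l \<in> L" "u \<noteq> [] \<longrightarrow> l \<noteq> inv (last u)" using that by (auto simp: red_append red_Cons)
      then have "inv (inv l) = l" by simp
      moreover from this have "u \<noteq> [] \<longrightarrow> inv l \<noteq> last u" using l(2) by metis
      ultimately show ?thesis using l(1) by (simp add: V_def)
    qed
    show thesis
    proof (cases "\<exists>l. red (u @ [l])")
      case True
      then obtain k where k: "red (u @ [k])" ..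
      have "D l = D k" if "red (u @ [l])" for l
        using const[of "inv l" "inv k"] V_red[OF k] V_red[OF that] by simp
      then show thesis using that by blast
    qed (use that in blast)
  qed
  \<comment> \<open>The cone consists of its apex and of one smaller cone for each branch.
    Finiteness of \<open>L\<close> makes the union of the exceptional sets finite.\<close>
  have "{t. red (u @ t) \<and> c (word_prod F (u @ t)) \<noteq> d} \<subseteq> {[]} \<union>
     (\<Union>l\<in>L. Cons l ` {t. red ((u @ [l]) @ t) \<and> c (word_prod F ((u @ [l]) @ t)) \<noteq> d})"
  proof
    fix t assume t: "t \<in> {t. red (u @ t) \<and> c (word_prod F (u @ t)) \<noteq> d}"
    show "t \<in> {[]} \<union>
       (\<Union>l\<in>L. Cons l ` {t. red ((u @ [l]) @ t) \<and> c (word_prod F ((u @ [l]) @ t)) \<noteq> d})"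
    proof (cases t)
      case (Cons l s)
      then have "l \<in> L" using t by (auto simp: red_append red_Cons)
      then show ?thesis using t Cons by auto
    qed simp
  qed
  moreover have "finite {t. red ((u @ [l]) @ t) \<and> c (word_prod F ((u @ [l]) @ t)) \<noteq> d}" for l
  proof (cases "red (u @ [l])")
    case True
    then show ?thesis using D[OF True] d[OF True] by (simp add: eventually_on_cone_def)
  next
    case False
    then have "\<not> red ((u @ [l]) @ t)" for t by (metis red_append)
    then show ?thesis by simp
  qed
  moreover have "finite L"
    using finite_letters[OF conn] red_letters[OF cyc_red[OF w]] by simp
  ultimately have "eventually_on_cone c u d"
    unfolding eventually_on_cone_def
    by (meson finite.emptyI finite.insertI finite_UN_I finite_UnI finite_imageI finite_subset)
  then show ?thesis ..
qed

text \<open>The condition \<open>axis\<close> is imposed for all rotations because every edge of the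
  Whitehead graph places its own point of the axis at the given vertex of the tree.\<close>

lemma colouring_eventually_constant:
  fixes c :: "'a \<Rightarrow> bool"
  assumes conn: "graph_connected (whitehead_graph_word F B w)"
    and cut: "\<And>v. \<not> cut_vertex (whitehead_graph_word F B w) v"
    and w: "cyc w"
    and axis: "\<And>g i. g \<in> carrier F \<Longrightarrow>
      \<exists>d. finite {n::nat. c (g \<otimes> word_prod F (rotate i w) [^] n) \<noteq> d} \<and>
          finite {n::nat. c (g \<otimes> inv (word_prod F (rotate i w)) [^] n) \<noteq> d}"
    and coboundary: "\<And>l. l \<in> L \<Longrightarrow> finite {g \<in> carrier F. c g \<noteq> c (g \<otimes> l)}"
  shows "\<exists>d. finite {g \<in> carrier F. c g \<noteq> d}"
proof -
  define E where "E = (\<Union>l\<in>L. {g \<in> carrier F. c g \<noteq> c (g \<otimes> l)})"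
  have "finite E"
    using coboundary finite_letters[OF conn] red_letters[OF cyc_red[OF w]] by (auto simp: E_def)
  then have "finite (len ` E)" by simp
  \<comment> \<open>From length \<open>N\<close> on, no edge of the tree changes the colour, so
    cones that far out have a single colour.\<close>
  then obtain N where N: "\<And>g. g \<in> E \<Longrightarrow> len g < N"
    using finite_nat_set_iff_bounded[of "len ` E"] by auto
  have "\<exists>d. eventually_on_cone c u d" if "red u" for u
    using that
  \<comment> \<open>Truncated subtraction gives all words of length at least \<open>N\<close> the
    measure zero; they are settled directly, without the induction hypothesis.\<close>
  proof (induction "N - length u" arbitrary: u rule: less_induct)
    case less
    show ?case
    proof (cases "length u < N")
      case True
      show ?thesis
      proof (rule cone_step[OF conn cut w axis \<open>red u\<close>])
        fix l assume "red (u @ [l])"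
        then show "\<exists>d. eventually_on_cone c (u @ [l]) d" using less(1)[of "u @ [l]"] True by simp
      qed
    next
      case False
      have "c (word_prod F (u @ t)) = c (word_prod F u)" if "red (u @ t)" for t
        using that
      proof (induction t rule: rev_induct)
        case (snoc l t)
        then have red: "red (u @ t)" "l \<in> L" by (auto simp: red_append red_Cons)
        have "word_prod F (u @ t) \<notin> E"
          using N[of "word_prod F (u @ t)"] False len_word_prod[OF red(1)] by auto
        then have "c (word_prod F (u @ t)) = c (word_prod F (u @ t) \<otimes> l)"
          using red word_prod_closed[OF red_closed[OF red(1)]] by (auto simp: E_def)
        also have "word_prod F (u @ t) \<otimes> l = word_prod F (u @ t @ [l])"
          using red word_prod_append[of "u @ t" "[l]"] red_closed[OF red(1)] by simp
        finally show ?case using snoc.IH[OF red(1)] by simp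
      qed simp
      then have "{t. red (u @ t) \<and> c (word_prod F (u @ t)) \<noteq> c (word_prod F u)} = {}" by blast
      then have "eventually_on_cone c u (c (word_prod F u))"
        by (simp only: eventually_on_cone_def finite.emptyI)
      then show ?thesis ..
    qed
  qed
  then obtain d where "eventually_on_cone c [] d" by force
  then have "finite (word_prod F ` {t. red t \<and> c (word_prod F t) \<noteq> d})"
    by (simp add: eventually_on_cone_def)
  moreover have "{g \<in> carrier F. c g \<noteq> d} \<subseteq> word_prod F ` {t. red t \<and> c (word_prod F t) \<noteq> d}"
    using red_word_of by (auto intro!: image_eqI[of _ _ "word_of _"])
  ultimately have "finite {g \<in> carrier F. c g \<noteq> d}" by (rule finite_subset[rotated])
  then show ?thesis ..
qed

theorem separable_imp_whitehead:
  assumes x: "x \<in> carrier F" and "separable F x"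
  shows "\<not> graph_connected (whitehead_graph F B x) \<or> (\<exists>v. cut_vertex (whitehead_graph F B x) v)"
proof (rule ccontr)
  assume contr: "\<not> ?thesis"
  define w where "w = cyclic_reduction F B x"
  have conn: "graph_connected (whitehead_graph_word F B w)"
    and cut: "\<And>v. \<not> cut_vertex (whitehead_graph_word F B w) v"
    using contr by (auto simp: whitehead_graph_def w_def)
  have w: "cyc w" and xw: "conjugate_in F x (word_prod F w)"
    unfolding w_def using cyclic_reduction[OF x] by auto
  obtain H K y where split: "is_free_product F H K" and HK: "H \<noteq> {\<one>}" "K \<noteq> {\<one>}"
    and y: "y \<in> H \<union> K" and xy: "conjugate_in F x y"
    using assms(2) by (auto simp: separable_def)
  interpret free_splitting F H K by unfold_locales (rule split)
  have y_closed: "y \<in> carrier F" using factor_closed[OF y] .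
  \<comment> \<open>Without letters the group would be trivial and could not have two non-trivial
    factors. Together with connectivity this makes \<open>w\<close> non-empty, hence
    \<open>y\<close> an element of infinite order.\<close>
  have "L \<noteq> {}"
  proof
    assume "L = {}"
    then have "word_of g = []" if "g \<in> carrier F" for g
      using red_letters[OF red_word_of[OF that]] by simp
    then have "g = \<one>" if "g \<in> carrier F" for g
      using word_prod_word_of[OF that] that by simp
    then have "carrier F = {\<one>}" by auto
    then show False
      using HK subgroup.subset[OF subgroup_H] subgroup.one_closed[OF subgroup_H] by auto
  qed
  then have "w \<noteq> []" using finite_letters[OF conn red_letters[OF cyc_red[OF w]]] by simp
  have axis: "\<exists>d. finite {n::nat. starts_in_H (g \<otimes> word_prod F (rotate i w) [^] n) \<noteq> d} \<and>
          finite {n::nat. starts_in_H (g \<otimes> inv (word_prod F (rotate i w)) [^] n) \<noteq> d}"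
    if g: "g \<in> carrier F" for g i
  proof -
    let ?r = "word_prod F (rotate i w)"
    have cyc: "cyc (rotate i w)" and ne: "rotate i w \<noteq> []"
      using cyc_rotate[OF w] \<open>w \<noteq> []\<close> by auto
    have r: "?r \<in> carrier F" using red_closed[OF cyc_red[OF cyc]] by (rule word_prod_closed)
    have "conjugate_in F y x" using conjugate_in_sym[OF xy x] .
    then have "conjugate_in F y (word_prod F w)" using conjugate_in_trans xw y_closed by blast
    then have "conjugate_in F y ?r"
      using conjugate_in_trans word_prod_rotate_conjugate[OF red_closed[OF cyc_red[OF w]]] y_closed by blast
    then obtain f where f: "f \<in> carrier F" "?r = f \<otimes> y \<otimes> inv f"
      by (auto simp: conjugate_in_def)
    have "inv ?r = f \<otimes> inv y \<otimes> inv f"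
      using f y_closed by (simp add: inv_mult_group m_assoc)
    then have inv_pow_r: "inv ?r [^] n = f \<otimes> inv y [^] n \<otimes> inv f" for n :: nat
      using f y_closed pow_conjugate by simp
    have "len (?r [^] n) = n * length w" for n :: nat
      using len_word_prod[OF red_concat_replicate[OF cyc, of n]] red_closed[OF cyc_red[OF cyc]]
      by (simp add: word_prod_concat_replicate length_concat sum_list_replicate)
    moreover have pow_r: "?r [^] n = f \<otimes> y [^] n \<otimes> inv f" for n :: nat
      using f y_closed pow_conjugate by simp
    ultimately have "n = m" if "y [^] n = y [^] m" for n m :: nat
      using that \<open>w \<noteq> []\<close> by (metis length_0_conv mult_cancel2)
    then have inj: "inj (\<lambda>n::nat. y [^] n)" by (rule injI)
    then have inj': "inj (\<lambda>n::nat. inv y [^] n)"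
      using y_closed by (auto simp: inj_def nat_pow_inv)
    have y': "inv y \<in> H \<union> K" "inv y \<in> H \<longleftrightarrow> y \<in> H"
      using y y_closed subgroup.m_inv_closed[OF subgroup_H] subgroup.m_inv_closed[OF subgroup_K]
      by (auto, metis inv_inv)
    \<comment> \<open>The powers along the axis are
      \<open>g \<otimes> f \<otimes> y [^] n \<otimes> inv f\<close>, and those in the other
      direction have \<open>inv y\<close> in place of \<open>y\<close>. The value depends on
      \<open>y\<close> only through \<open>y \<in> H\<close>, so it serves both ends.\<close>
    let ?d = "y \<in> H \<and> g \<otimes> f \<in> H \<or> starts_in_H (g \<otimes> f)"
    have "finite {n::nat. starts_in_H (g \<otimes> ?r [^] n) \<noteq> ?d}"
      using starts_in_H_pow[OF y inj, of "g \<otimes> f" "inv f"] f(1) g y_closed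
      unfolding pow_r by (simp add: m_assoc)
    moreover have "finite {n::nat. starts_in_H (g \<otimes> inv ?r [^] n) \<noteq> ?d}"
      using starts_in_H_pow[OF y'(1) inj', of "g \<otimes> f" "inv f"] f(1) g y_closed y'(2)
      unfolding inv_pow_r by (simp add: m_assoc)
    ultimately show ?thesis by blast
  qed
  obtain d where "finite {g \<in> carrier F. starts_in_H g \<noteq> d}"
    using colouring_eventually_constant[OF conn cut w axis] finite_coboundary by auto
  then show False using infinite_sides[OF HK] by blast
qed

end

section \<open>Free factors spanned by letters\<close>

context based_free_group
begin

text \<open>Words over \<open>C\<close> alone are used, so this is the submonoid generated by
  \<open>C\<close>; it is a subgroup once \<open>C\<close> is closed under inversion.\<close>

definition letter_span :: "'a set \<Rightarrow> 'a set" where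
  "letter_span C = word_prod F ` {w. set w \<subseteq> C}"

text \<open>Reducing a word only removes letters, so the reduced word still uses letters of
  \<open>C\<close>.\<close>

lemma in_letter_span_iff:
  assumes "C \<subseteq> L"
  shows "g \<in> letter_span C \<longleftrightarrow> g \<in> carrier F \<and> set (word_of g) \<subseteq> C"
proof
  assume "g \<in> letter_span C"
  then obtain w where w: "g = word_prod F w" "set w \<subseteq> C" by (auto simp: letter_span_def)
  have "set (word_of (word_prod F w)) \<subseteq> C"
    using w(2)
  proof (induction w)
    case (Cons l w)
    then have "set w \<subseteq> L" "l \<in> L" using assms by auto
    moreover have "set (tl (word_of (word_prod F w))) \<subseteq> C"
      using Cons by (cases "word_of (word_prod F w)") auto
    ultimately show ?case using Cons by (simp add: word_of_mult_letter)
  qed simp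
  with w assms show "g \<in> carrier F \<and> set (word_of g) \<subseteq> C"
    using letters_word_closed[of w] by auto
next
  assume "g \<in> carrier F \<and> set (word_of g) \<subseteq> C"
  then show "g \<in> letter_span C"
    unfolding letter_span_def by (auto intro!: image_eqI[of _ _ "word_of g"])
qed

lemma subgroup_letter_span:
  assumes "C \<subseteq> L" "\<And>l. l \<in> C \<Longrightarrow> inv l \<in> C"
  shows "subgroup (letter_span C) F"
proof (rule subgroupI)
  have closed: "set w \<subseteq> carrier F" if "set w \<subseteq> C" for w
    using that assms(1) by simp
  show "letter_span C \<subseteq> carrier F" using closed by (auto simp: letter_span_def)
  have "word_prod F [] \<in> letter_span C" unfolding letter_span_def by (intro imageI) simp
  then show "letter_span C \<noteq> {}" by blast
  fix g assume "g \<in> letter_span C"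
  then obtain u where u: "g = word_prod F u" "set u \<subseteq> C" by (auto simp: letter_span_def)
  have "inv g = word_prod F (rev (map (m_inv F) u))"
    using inv_word_prod[OF closed[OF u(2)]] u(1) by simp
  moreover have "set (rev (map (m_inv F) u)) \<subseteq> C" using u(2) assms(2) by auto
  ultimately show "inv g \<in> letter_span C" unfolding letter_span_def by blast
  fix h assume "h \<in> letter_span C"
  then obtain v where v: "h = word_prod F v" "set v \<subseteq> C" by (auto simp: letter_span_def)
  have "g \<otimes> h = word_prod F (u @ v)"
    using u v word_prod_append[OF closed closed] by simp
  moreover have "set (u @ v) \<subseteq> C" using u v by simp
  ultimately show "g \<otimes> h \<in> letter_span C" unfolding letter_span_def by blast
qed

lemma letter_in_letter_span: "l \<in> C \<Longrightarrow> C \<subseteq> L \<Longrightarrow> l \<in> letter_span C"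
  using in_letter_span_iff[of C l] by (auto simp: word_of_letter)

end

text \<open>A set of letters closed under inversion amounts to a subset of the basis; its complement
  in \<open>L\<close> gives the other factor.\<close>

locale letter_splitting = based_free_group F B for F :: "('a, 'm) monoid_scheme" (structure) and B +
  fixes C :: "'a set"
  assumes C_subset: "C \<subseteq> L" and C_inv: "\<And>l. l \<in> C \<Longrightarrow> inv l \<in> C"
begin

abbreviation H :: "'a set" where "H \<equiv> letter_span C"
abbreviation K :: "'a set" where "K \<equiv> letter_span (L - C)"

abbreviation opposite :: "'a \<Rightarrow> 'a \<Rightarrow> bool" where
  "opposite a b \<equiv> (a \<in> H \<and> b \<in> K) \<or> (a \<in> K \<and> b \<in> H)"

definition alternating :: "'a list \<Rightarrow> bool" where
  "alternating v \<longleftrightarrow> set v \<subseteq> (H \<union> K) - {\<one>} \<and> successively opposite v"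

text \<open>Undoes the cutting of a reduced word at the places where it passes between
  \<open>C\<close> and its complement. Normal forms are compared with reduced words through this
  map.\<close>

definition spelling :: "'a list \<Rightarrow> 'a list" where
  "spelling v = concat (map word_of v)"

lemma spelling_Nil [simp]: "spelling [] = []"
  and spelling_Cons [simp]: "spelling (a # v) = word_of a @ spelling v"
  by (simp_all add: spelling_def)

lemma alternating_Nil [simp]: "alternating []"
  by (simp add: alternating_def)

lemma alternating_Cons:
  "alternating (a # v) \<longleftrightarrow>
     a \<in> (H \<union> K) - {\<one>} \<and> alternating v \<and> (v \<noteq> [] \<longrightarrow> opposite a (hd v))"
  by (auto simp: alternating_def successively_Cons)

lemma inv_C_iff:
  assumes "l \<in> L"
  shows "inv l \<in> C \<longleftrightarrow> l \<in> C"
  using C_inv[of l] C_inv[of "inv l"] assms by auto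

lemma subgroup_H: "subgroup H F"
  using subgroup_letter_span[OF C_subset C_inv] .

lemma subgroup_K: "subgroup K F"
proof (rule subgroup_letter_span)
  fix l assume "l \<in> L - C"
  then show "inv l \<in> L - C" using inv_C_iff[of l] by simp
qed simp

lemma factor_closed: "a \<in> H \<union> K \<Longrightarrow> a \<in> carrier F"
  using subgroup.subset[OF subgroup_H] subgroup.subset[OF subgroup_K] by auto

lemma letters_of_H: "a \<in> H \<Longrightarrow> set (word_of a) \<subseteq> C"
  and letters_of_K: "a \<in> K \<Longrightarrow> set (word_of a) \<subseteq> L - C"
  using in_letter_span_iff[OF C_subset] in_letter_span_iff[OF Diff_subset] by simp_all

lemma word_of_neq_Nil: "a \<in> (H \<union> K) - {\<one>} \<Longrightarrow> word_of a \<noteq> []"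
  using word_prod_word_of[of a, symmetric] factor_closed[of a] by fastforce

lemma H_Int_K: "H \<inter> K = {\<one>}"
proof
  show "H \<inter> K \<subseteq> {\<one>}"
  proof
    fix g assume g: "g \<in> H \<inter> K"
    then have "set (word_of g) \<subseteq> C" "set (word_of g) \<subseteq> L - C"
      using letters_of_H letters_of_K by simp_all
    then have "set (word_of g) = {}" by (meson DiffD2 subset_empty subset_iff)
    then show "g \<in> {\<one>}" using word_of_neq_Nil[of g] g by auto
  qed
  show "{\<one>} \<subseteq> H \<inter> K"
    using subgroup.one_closed[OF subgroup_H] subgroup.one_closed[OF subgroup_K] by simp
qed

text \<open>The element \<open>l\<close> is put in front of the first syllable, merged with it, or
  cancelled against it.\<close>

lemma alternating_mult_letter:
  assumes ST: "S = H \<and> T = K \<or> S = K \<and> T = H"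
    and l: "l \<in> S" "l \<noteq> \<one>" and v: "alternating v"
  shows "\<exists>v'. alternating v' \<and> word_prod F v' = l \<otimes> word_prod F v"
proof (cases v)
  case Nil
  have "l \<in> H \<union> K" using l ST by auto
  then show ?thesis
    using Nil l factor_closed by (intro exI[of _ "[l]"]) (simp add: alternating_Cons)
next
  case (Cons a s)
  have opp: "opposite b c \<longleftrightarrow> b \<in> S \<and> c \<in> T \<or> b \<in> T \<and> c \<in> S" for b c
    using ST by auto
  have HK: "H \<union> K = S \<union> T" and sub: "subgroup S F" and Int: "S \<inter> T = {\<one>}"
    using ST subgroup_H subgroup_K H_Int_K by auto
  have "set v \<subseteq> carrier F" using v factor_closed by (auto simp: alternating_def)
  then have closed: "a \<in> carrier F" "set s \<subseteq> carrier F" "l \<in> carrier F"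
    using Cons l HK factor_closed by auto
  have a: "a \<in> S \<union> T" "a \<noteq> \<one>" and s: "alternating s" and as: "s \<noteq> [] \<Longrightarrow> opposite a (hd s)"
    using v Cons HK by (auto simp: alternating_Cons)
  show ?thesis
  proof (cases "a \<in> S")
    case True
    have la: "l \<otimes> a \<in> S" using subgroup.m_closed[OF sub l(1) True] .
    have "a \<notin> T" using True a(2) Int by auto
    then have hd_s: "s \<noteq> [] \<Longrightarrow> hd s \<in> T" using as unfolding opp by auto
    have prod: "l \<otimes> word_prod F v = (l \<otimes> a) \<otimes> word_prod F s"
      using closed Cons by (simp add: m_assoc)
    show ?thesis
    proof (cases "l \<otimes> a = \<one>")
      case True
      then show ?thesis using s prod closed by (intro exI[of _ s]) simp
    next
      case False
      have "alternating ((l \<otimes> a) # s)"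
        using s la False hd_s unfolding alternating_Cons HK opp by simp
      then show ?thesis using prod by (intro exI[of _ "(l \<otimes> a) # s"]) simp
    qed
  next
    case False
    then have "alternating (l # v)"
      using a v Cons l unfolding alternating_Cons[of l] HK opp by simp
    then show ?thesis by (intro exI[of _ "l # v"]) simp
  qed
qed

lemma exists_alternating: "set w \<subseteq> L \<Longrightarrow> \<exists>v. alternating v \<and> word_prod F v = word_prod F w"
proof (induction w)
  case Nil
  then show ?case by (intro exI[of _ "[]"]) simp
next
  case (Cons l w)
  then obtain v where v: "alternating v" "word_prod F v = word_prod F w" by auto
  have l: "l \<in> L" "l \<noteq> \<one>" using Cons one_not_letter by auto
  show ?case
  proof (cases "l \<in> C")
    case True
    then show ?thesis
      using alternating_mult_letter[of H K l v] letter_in_letter_span[of l C] l v C_subset by simp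
  next
    case False
    then show ?thesis
      using alternating_mult_letter[of K H l v] letter_in_letter_span[of l "L - C"] l v by simp
  qed
qed

lemma opposite_letters:
  assumes "a \<in> (H \<union> K) - {\<one>}" "b \<in> (H \<union> K) - {\<one>}" "opposite a b"
    and l: "l \<in> set (word_of a)"
  shows "hd (word_of b) \<in> C \<longleftrightarrow> l \<notin> C"
proof -
  have "hd (word_of b) \<in> set (word_of b)"
    using word_of_neq_Nil[OF assms(2)] by simp
  then show ?thesis
    using assms(3) l letters_of_H letters_of_K by blast
qed

lemma hd_spelling:
  assumes "alternating v" "v \<noteq> []"
  shows "spelling v \<noteq> [] \<and> hd (spelling v) = hd (word_of (hd v))"
  using assms word_of_neq_Nil[of "hd v"] by (cases v) (auto simp: alternating_Cons)

lemma spelling: "alternating v \<Longrightarrow> red (spelling v) \<and> word_prod F (spelling v) = word_prod F v"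
proof (induction v)
  case (Cons a v)
  have a: "a \<in> (H \<union> K) - {\<one>}" and v: "alternating v"
    and av: "v \<noteq> [] \<Longrightarrow> opposite a (hd v)"
    using Cons.prems by (simp_all add: alternating_Cons)
  have a_closed: "a \<in> carrier F" using a factor_closed by blast
  have last: "last (word_of a) \<in> set (word_of a)" "last (word_of a) \<in> L"
    using word_of_neq_Nil[OF a] red_last_letter[OF red_word_of[OF a_closed]] by simp_all
  have "hd (spelling v) \<noteq> inv (last (word_of a))" if ne: "spelling v \<noteq> []"
  proof -
    have v_ne: "v \<noteq> []" using ne by auto
    then have "hd v \<in> (H \<union> K) - {\<one>}" using v by (cases v) (auto simp: alternating_Cons)
    then have "hd (spelling v) \<in> C \<longleftrightarrow> last (word_of a) \<notin> C"
      using opposite_letters[OF a _ av[OF v_ne] last(1)] hd_spelling[OF v v_ne] by simp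
    \<comment> \<open>Inverse letters lie on the same side of \<open>C\<close>, whereas the letters
      meeting between two syllables lie on different sides; so nothing cancels.\<close>
    then show ?thesis using inv_C_iff[OF last(2)] by auto
  qed
  then have "red (word_of a @ spelling v)"
    using Cons.IH[OF v] red_word_of[OF a_closed] by (simp add: red_append)
  then show ?case
    using Cons.IH[OF v] a_closed red_closed[OF red_word_of[OF a_closed]] red_closed[of "spelling v"]
    by (simp add: word_prod_append)
qed simp

text \<open>Recovers the first syllable from the spelled word: it is the longest prefix staying on
  one side of \<open>C\<close>. Injectivity of \<open>spelling\<close> rests on this.\<close>

lemma takeWhile_spelling:
  assumes "alternating (a # v)"
  shows "takeWhile (\<lambda>l. l \<in> C \<longleftrightarrow> hd (spelling (a # v)) \<in> C) (spelling (a # v)) = word_of a"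
proof -
  have a: "a \<in> (H \<union> K) - {\<one>}" and v: "alternating v"
    and av: "v \<noteq> [] \<Longrightarrow> opposite a (hd v)"
    using assms by (simp_all add: alternating_Cons)
  have hd_a: "hd (word_of a) \<in> set (word_of a)" "hd (spelling (a # v)) = hd (word_of a)"
    using word_of_neq_Nil[OF a] by simp_all
  define P where "P = (\<lambda>l. l \<in> C \<longleftrightarrow> hd (spelling (a # v)) \<in> C)"
  have P: "P l" if "l \<in> set (word_of a)" for l
    using a that hd_a letters_of_H[of a] letters_of_K[of a] unfolding P_def by auto
  have "takeWhile P (spelling v) = []"
  proof (cases "v = []")
    case False
    then have "hd v \<in> (H \<union> K) - {\<one>}" using v by (cases v) (auto simp: alternating_Cons)
    then have "\<not> P (hd (spelling v))"
      using opposite_letters[OF a _ av[OF False] hd_a(1)] hd_spelling[OF v False] hd_a(2)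
      unfolding P_def by simp
    then show ?thesis using hd_spelling[OF v False] by (cases "spelling v") auto
  qed simp
  then have "takeWhile P (spelling (a # v)) = word_of a"
    using P by (simp add: takeWhile_append2)
  then show ?thesis by (simp only: P_def)
qed

lemma spelling_inj: "alternating u \<Longrightarrow> alternating v \<Longrightarrow> spelling u = spelling v \<Longrightarrow> u = v"
proof (induction u arbitrary: v)
  case Nil
  then show ?case using hd_spelling[of v] by (cases "v = []") auto
next
  case (Cons a s)
  have "v \<noteq> []" using Cons.prems hd_spelling[of "a # s"] by auto
  then obtain b t where v: "v = b # t" by (cases v) auto
  have "word_of a = word_of b"
    using takeWhile_spelling[OF Cons.prems(1)] takeWhile_spelling[of b t] Cons.prems(2,3)
    unfolding v by metis
  moreover have "a \<in> carrier F" "b \<in> carrier F"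
    using Cons.prems factor_closed unfolding v by (auto simp: alternating_Cons)
  ultimately have "a = b" by (metis word_prod_word_of)
  moreover have "spelling s = spelling t" using Cons.prems(3) v \<open>a = b\<close> by simp
  ultimately show ?case
    using Cons.IH[of t] Cons.prems(1,2) unfolding v by (simp add: alternating_Cons)
qed

lemma is_free_product_letter_span: "is_free_product F H K"
proof -
  have "\<exists>!v. alternating v \<and> word_prod F v = g" if g: "g \<in> carrier F" for g
  proof (rule ex_ex1I)
    show "\<exists>v. alternating v \<and> word_prod F v = g"
      using exists_alternating[OF red_letters[OF red_word_of[OF g]]] g by simp
    fix u v assume uv: "alternating u \<and> word_prod F u = g" "alternating v \<and> word_prod F v = g"
    then have "spelling u = spelling v"
      using spelling[of u] spelling[of v] by (intro word_prod_inj) simp_all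
    then show "u = v" using spelling_inj uv by blast
  qed
  then show ?thesis
    unfolding is_free_product_def alternating_def
    using subgroup_H subgroup_K H_Int_K by (simp add: conj_assoc)
qed

end

section \<open>Separability from letter sets, and the infinite cyclic case\<close>

context based_free_group
begin

lemma separable_if_invariant_letters:
  assumes x: "x \<in> carrier F" and w: "set w \<subseteq> L" "conjugate_in F x (word_prod F w)"
    and C: "C \<subseteq> L" "C \<noteq> {}" "C \<noteq> L" "\<And>l. l \<in> C \<Longrightarrow> inv l \<in> C"
    and side: "set w \<subseteq> C \<or> set w \<inter> C = {}"
  shows "separable F x"
proof -
  have "letter_span D \<noteq> {\<one>}" if "D \<subseteq> L" "D \<noteq> {}" for D
    using that letter_in_letter_span[of _ D] one_not_letter by fastforce
  then have "letter_span C \<noteq> {\<one>}" "letter_span (L - C) \<noteq> {\<one>}" using C by auto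
  moreover have "word_prod F w \<in> letter_span C \<union> letter_span (L - C)"
    using side w(1) unfolding letter_span_def by blast
  moreover have "is_free_product F (letter_span C) (letter_span (L - C))"
  proof -
    interpret letter_splitting F B C by unfold_locales (use C in auto)
    show ?thesis by (rule is_free_product_letter_span)
  qed
  ultimately show ?thesis
    unfolding separable_def using w(2) by blast
qed

text \<open>Identifies the exceptional case, in which \<open>b\<close> and its inverse exhaust the
  letters and leave no proper splitting. The powers of \<open>b\<close> are distinct because they
  are spelled by reduced words \<open>b b ... b\<close>.\<close>

lemma iso_integer_group:
  assumes b: "b \<in> L" and L: "L \<subseteq> {b, inv b}"
  shows "F \<cong> integer_group"
proof -
  have b_closed: "b \<in> carrier F" using b by simp
  have neq: "b \<noteq> inv b" using inv_letter_neq[OF b] by simp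
  have pow_nat: "b [^] n \<noteq> \<one>" if "n > 0" for n :: nat
  proof
    assume eq: "b [^] n = \<one>"
    have "cyc [b]" using b neq by (simp add: cyclically_reduced_word_def red_Cons)
    then have "red (concat (replicate n [b]))" by (rule red_concat_replicate)
    moreover have "word_prod F (concat (replicate n [b])) = word_prod F []"
      using word_prod_concat_replicate[of "[b]" n] b_closed eq by simp
    ultimately have "concat (replicate n [b]) = []" by (intro word_prod_inj red_Nil)
    then show False using that by simp
  qed
  have pow_int: "b [^] k \<noteq> \<one>" if "k \<noteq> 0" for k :: int
  proof (cases "k > 0")
    case True
    then show ?thesis using pow_nat[of "nat k"] int_pow_int[of F b "nat k"] by simp
  next
    case False
    then have "b [^] (- k) \<noteq> \<one>"
      using that pow_nat[of "nat (- k)"] int_pow_int[of F b "nat (- k)"] by simp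
    then show ?thesis using b_closed by (simp add: int_pow_neg)
  qed
  have "inj (\<lambda>k::int. b [^] k)"
  proof (rule injI)
    fix j k :: int assume "b [^] j = b [^] k"
    then have "b [^] (j - k) = \<one>" using b_closed by (simp add: int_pow_diff)
    then show "j = k" using pow_int[of "j - k"] by auto
  qed
  moreover have "\<exists>k::int. word_prod F w = b [^] k" if "set w \<subseteq> L" for w
    using that
  proof (induction w)
    case (Cons l w)
    then obtain k :: int where k: "word_prod F w = b [^] k" by auto
    have "l = b \<or> l = inv b" using Cons.prems L by auto
    then show ?case
    proof
      assume "l = b"
      then have "word_prod F (l # w) = b [^] (1 + k)"
        using k b_closed by (simp add: int_pow_mult)
      then show ?case by blast
    next
      assume "l = inv b"
      then have "word_prod F (l # w) = b [^] (- 1 + k)"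
        using k b_closed int_pow_mult[OF b_closed, of "- 1" k] int_pow_neg[OF b_closed, of 1] by simp
      then show ?case by blast
    qed
  qed (auto intro: exI[of _ "0::int"])
  then have "carrier F \<subseteq> range (\<lambda>k::int. b [^] k)"
    using red_letters[OF red_word_of] word_prod_word_of by (metis rangeI subsetI)
  ultimately have "bij_betw (\<lambda>k::int. b [^] k) (carrier integer_group) (carrier F)"
    using b_closed by (auto simp: bij_betw_def)
  then have "(\<lambda>k::int. b [^] k) \<in> iso integer_group F"
    using hom_integer_group_pow[OF b_closed] by (simp add: iso_def)
  then show ?thesis
    using group.iso_sym[OF group_integer_group] is_isoI by blast
qed

end

section \<open>Whitehead automorphisms\<close>

context based_free_group
begin

text \<open>The assumption \<open>inverse\<close> speaks about arbitrary extensions of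
  \<open>f\<close> and \<open>g\<close>, so that it can be checked by the laws of homomorphisms
  before any extension has been chosen.\<close>

lemma iso_extending:
  assumes f: "\<And>l. l \<in> L \<Longrightarrow> f l \<in> carrier F" "\<And>l. l \<in> L \<Longrightarrow> f (inv l) = inv (f l)"
    and g: "\<And>l. l \<in> L \<Longrightarrow> g l \<in> carrier F" "\<And>l. l \<in> L \<Longrightarrow> g (inv l) = inv (g l)"
    and inverse: "\<And>\<phi> \<psi> l. \<phi> \<in> hom F F \<Longrightarrow> \<psi> \<in> hom F F \<Longrightarrow> \<forall>l\<in>L. \<phi> l = f l \<Longrightarrow>
      \<forall>l\<in>L. \<psi> l = g l \<Longrightarrow> l \<in> L \<Longrightarrow> \<psi> (f l) = l \<and> \<phi> (g l) = l"
  shows "\<exists>\<phi>\<in>iso F F. \<forall>l\<in>L. \<phi> l = f l"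
proof -
  obtain \<phi> where \<phi>: "\<phi> \<in> hom F F" "\<forall>l\<in>L. \<phi> l = f l"
    using extend_hom[of F f, OF is_group f] by auto
  obtain \<psi> where \<psi>: "\<psi> \<in> hom F F" "\<forall>l\<in>L. \<psi> l = g l"
    using extend_hom[of F g, OF is_group g] by auto
  note inv = inverse[OF \<phi>(1) \<psi>(1) \<phi>(2) \<psi>(2)]
  have "\<psi> \<circ> \<phi> \<in> hom F F" "\<phi> \<circ> \<psi> \<in> hom F F"
    using \<phi>(1) \<psi>(1) Group.hom_compose by blast+
  then have "(\<psi> \<circ> \<phi>) h = h" "(\<phi> \<circ> \<psi>) h = h" if "h \<in> carrier F" for h
    using hom_identity[of "\<psi> \<circ> \<phi>" h] hom_identity[of "\<phi> \<circ> \<psi>" h] inv \<phi>(2) \<psi>(2) that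
    by simp_all
  then have "bij_betw \<phi> (carrier F) (carrier F)"
    using \<phi>(1) \<psi>(1) by (intro bij_betw_byWitness[where f' = \<psi>]) (auto intro: hom_in_carrier)
  then show ?thesis using \<phi> by (auto simp: iso_def)
qed

text \<open>The Whitehead automorphism with multiplier \<open>a\<close>. Along the cyclic word \<open>w\<close>, each edge of the
  Whitehead graph that meets \<open>S\<close> is given the weight \<open>a\<close>; conjugating by these weights
  cancels the correcting factors of the automorphism and one letter for each edge joining
  \<open>a\<close> to \<open>S\<close>.\<close>

lemma whitehead_automorphism_shortens:
  assumes w: "set w \<subseteq> L" and a: "a \<in> L" "a \<notin> S" "inv a \<notin> S"
    and edge: "\<And>i. i < length w \<Longrightarrow> w ! i \<in> S \<Longrightarrow> inv (w ! (Suc i mod length w)) \<in> insert a S"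
      "\<And>i. i < length w \<Longrightarrow> inv (w ! (Suc i mod length w)) \<in> S \<Longrightarrow> w ! i \<in> insert a S"
    and i: "i < length w"
      "w ! i = a \<and> inv (w ! (Suc i mod length w)) \<in> S \<or>
       w ! i \<in> S \<and> inv (w ! (Suc i mod length w)) = a"
  shows "\<exists>\<phi>\<in>iso F F. \<exists>v. set v \<subseteq> L \<and> length v < length w \<and>
    conjugate_in F (\<phi> (word_prod F w)) (word_prod F v)"
proof -
  define \<chi> where "\<chi> l = (if l \<in> S then a else \<one>)" for l
  \<comment> \<open>A letter is multiplied by \<open>a\<close> on the right if it lies in
    \<open>S\<close>, and by \<open>inv a\<close> on the left if its inverse does; both may happen.
    Since neither \<open>a\<close> nor \<open>inv a\<close> is in \<open>S\<close>, the multiplier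
    is fixed, and \<open>g\<close> with \<open>inv a\<close> in place of \<open>a\<close> is the
    inverse.\<close>
  define f where "f l = inv (\<chi> (inv l)) \<otimes> l \<otimes> \<chi> l" for l
  define g where "g l = \<chi> (inv l) \<otimes> l \<otimes> inv (\<chi> l)" for l
  have \<chi>_closed [simp]: "\<chi> l \<in> carrier F" for l using a(1) by (simp add: \<chi>_def)
  have f_closed: "f l \<in> carrier F" if "l \<in> L" for l using that by (simp add: f_def)
  have fa: "f a = a" and ga: "g a = a" and fa': "f (inv a) = inv a"
    using a by (simp_all add: f_def g_def \<chi>_def)
  have "\<exists>\<phi>\<in>iso F F. \<forall>l\<in>L. \<phi> l = f l"
  proof (rule iso_extending[where g = g])
    fix \<phi> \<psi> l assume \<phi>: "\<phi> \<in> hom F F" "\<forall>l\<in>L. \<phi> l = f l" and \<psi>: "\<psi> \<in> hom F F" "\<forall>l\<in>L. \<psi> l = g l"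
      and l: "l \<in> L"
    interpret \<phi>: group_hom F F \<phi> by unfold_locales (fact \<phi>(1))
    interpret \<psi>: group_hom F F \<psi> by unfold_locales (fact \<psi>(1))
    have "\<phi> (\<chi> k) = \<chi> k" "\<psi> (\<chi> k) = \<chi> k" for k
      using \<phi>(2) \<psi>(2) fa ga a(1) by (simp_all add: \<chi>_def)
    then show "\<psi> (f l) = l \<and> \<phi> (g l) = l"
      using l \<phi>(2) \<psi>(2) by (simp add: f_def g_def m_assoc)
  qed (simp_all add: f_def g_def inv_mult_group m_assoc)
  then obtain \<phi> where \<phi>: "\<phi> \<in> iso F F" "\<forall>l\<in>L. \<phi> l = f l" by blast
  then have hom: "\<phi> \<in> hom F F" by (simp add: iso_def)
  let ?n = "length w"
  have n: "?n > 0" using i(1) by linarith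
  define u where "u j = w ! (j mod ?n)" for j
  have u_L: "u j \<in> L" for j using w n by (auto simp: u_def)
  have u_edge: "u j \<in> S \<Longrightarrow> inv (u (Suc j)) \<in> insert a S"
    "inv (u (Suc j)) \<in> S \<Longrightarrow> u j \<in> insert a S" for j
    using edge[of "j mod ?n"] n by (simp_all add: u_def mod_Suc_eq)
  define E where "E j = (if u j \<in> S \<or> inv (u (Suc j)) \<in> S then a else \<one>)" for j
  have E_closed [simp]: "E j \<in> carrier F" for j using a(1) by (simp add: E_def)
  \<comment> \<open>The letter \<open>u (Suc j)\<close> sits between edges \<open>j\<close> and
    \<open>Suc j\<close>, so its image is framed by their weights. A letter other than
    \<open>a\<close> and \<open>inv a\<close> survives unchanged, since its correcting factors are
    exactly these weights; \<open>a\<close> vanishes if its outgoing edge has weight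
    \<open>a\<close>, and \<open>inv a\<close> if its incoming edge has.\<close>
  define \<rho> where "\<rho> j = E j \<otimes> f (u (Suc j)) \<otimes> inv (E (Suc j))" for j
  have \<rho>: "\<rho> j = u (Suc j) \<or> \<rho> j = \<one>" for j
  proof -
    let ?l = "u (Suc j)"
    have l: "?l \<in> L" by (rule u_L)
    consider "?l = a" | "?l = inv a" | "?l \<noteq> a" "?l \<noteq> inv a" by blast
    then show ?thesis
    proof cases
      case 1
      then have "E j = \<one>" using a u_edge(1)[of j] inv_letter_neq[OF a(1)] by (auto simp: E_def)
      then have "\<rho> j = a \<otimes> inv (E (Suc j))" using 1 fa a(1) by (simp add: \<rho>_def)
      then show ?thesis using 1 a(1) by (cases "E (Suc j) = \<one>") (auto simp: E_def split: if_splits)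
    next
      case 2
      then have "E (Suc j) = \<one>"
        using a u_edge(2)[of "Suc j"] inv_letter_neq[OF a(1)] by (auto simp: E_def)
      then have "\<rho> j = E j \<otimes> inv a" using 2 fa' a(1) by (simp add: \<rho>_def)
      then show ?thesis using 2 a(1) by (auto simp: E_def)
    next
      case 3
      have "inv ?l \<noteq> a" using 3(2) l by auto
      then have "E j = \<chi> (inv ?l)" using u_edge(1)[of j] by (auto simp: E_def \<chi>_def)
      moreover have "E (Suc j) = \<chi> ?l" using 3(1) u_edge(2)[of "Suc j"] by (auto simp: E_def \<chi>_def)
      ultimately show ?thesis using l by (simp add: \<rho>_def f_def m_assoc)
    qed
  qed
  have \<rho>_one: "\<exists>j<?n. \<rho> j = \<one>"
    using i(2)
  proof
    assume *: "w ! i \<in> S \<and> inv (w ! (Suc i mod ?n)) = a"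
    then have "E i = a" "inv (u (Suc i)) = a" using i(1) by (auto simp: E_def u_def)
    then have ui: "u (Suc i) = inv a" using u_L[of "Suc i"] by (metis inv_inv letter_closed)
    then have "E (Suc i) = \<one>"
      using a u_edge(2)[of "Suc i"] inv_letter_neq[OF a(1)] by (auto simp: E_def)
    then have "\<rho> i = \<one>" using \<open>E i = a\<close> ui fa' a(1) by (simp add: \<rho>_def)
    then show ?thesis using i(1) by blast
  next
    assume *: "w ! i = a \<and> inv (w ! (Suc i mod ?n)) \<in> S"
    \<comment> \<open>The cyclic predecessor of \<open>i\<close>, because \<open>\<rho> k\<close>
      belongs to the letter at position \<open>Suc k\<close>. Adding the length before subtracting
      keeps the case \<open>i = 0\<close> correct.\<close>
    define k where "k = (i + ?n - 1) mod ?n"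
    have "Suc k mod ?n = Suc (i + ?n - 1) mod ?n" unfolding k_def by (rule mod_Suc_eq)
    also have "\<dots> = i" using n i(1) by simp
    finally have k: "k < ?n" "Suc k mod ?n = i" using n by (auto simp: k_def)
    then have uk: "u (Suc k) = a" using * by (simp add: u_def)
    have "Suc (Suc k) mod ?n = Suc i mod ?n" using k(2) mod_Suc_eq[of "Suc k" ?n] by simp
    then have "E (Suc k) = a" using * by (simp add: E_def u_def)
    moreover have "E k = \<one>"
      using uk a u_edge(1)[of k] inv_letter_neq[OF a(1)] by (auto simp: E_def)
    ultimately have "\<rho> k = \<one>" using uk fa a(1) by (simp add: \<rho>_def)
    then show ?thesis using k(1) by blast
  qed
  \<comment> \<open>Inner weights cancel, and after one full turn the two outer ones agree, so the
    product is a conjugate. It spells \<open>rotate1 w\<close> because \<open>\<rho> 0\<close>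
    belongs to the letter at position one.\<close>
  have telescope: "word_prod F (map \<rho> [0..<m]) =
      E 0 \<otimes> word_prod F (map f (map (\<lambda>j. u (Suc j)) [0..<m])) \<otimes> inv (E m)" for m
  proof (induction m)
    case (Suc m)
    let ?p = "word_prod F (map f (map (\<lambda>j. u (Suc j)) [0..<m]))"
    have closed: "set (map f (map (\<lambda>j. u (Suc j)) [0..<m])) \<subseteq> carrier F" "f (u (Suc m)) \<in> carrier F"
      "set (map \<rho> [0..<m]) \<subseteq> carrier F" "\<rho> m \<in> carrier F"
      using f_closed[OF u_L] by (auto simp: \<rho>_def)
    then have p: "?p \<in> carrier F" by (intro word_prod_closed)
    have \<rho>_m: "\<rho> m = E m \<otimes> f (u (Suc m)) \<otimes> inv (E (Suc m))" by (rule \<rho>_def)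
    have "word_prod F (map \<rho> [0..<Suc m]) = word_prod F (map \<rho> [0..<m]) \<otimes> \<rho> m"
      using word_prod_append[OF closed(3), of "[\<rho> m]"] closed(4) by simp
    also have "\<dots> = E 0 \<otimes> (?p \<otimes> f (u (Suc m))) \<otimes> inv (E (Suc m))"
      using p closed(2) by (simp add: Suc \<rho>_m m_assoc del: map_map)
    also have "?p \<otimes> f (u (Suc m)) = word_prod F (map f (map (\<lambda>j. u (Suc j)) [0..<Suc m]))"
      using word_prod_append[OF closed(1), of "[f (u (Suc m))]"] closed(2) by simp
    finally show ?case .
  qed simp
  have rot: "map (\<lambda>j. u (Suc j)) [0..<?n] = rotate1 w"
    by (rule nth_equalityI) (auto simp: u_def nth_rotate1)
  define v where "v = filter (\<lambda>b. b \<noteq> \<one>) (map \<rho> [0..<?n])"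
  have \<rho>_closed: "set (map \<rho> [0..<?n]) \<subseteq> carrier F"
    using f_closed[OF u_L] by (auto simp: \<rho>_def)
  have "set v \<subseteq> L" using \<rho> u_L by (auto simp: v_def) metis
  moreover have "length v < length w"
  proof -
    obtain j where "j < ?n" "\<rho> j = \<one>" using \<rho>_one by blast
    then have "length v < length (map \<rho> [0..<?n])"
      unfolding v_def by (intro length_filter_less[of \<one>]) (auto intro: image_eqI[of _ _ j])
    then show ?thesis by simp
  qed
  moreover have "conjugate_in F (\<phi> (word_prod F w)) (word_prod F v)"
  proof -
    have w_closed: "set w \<subseteq> carrier F" using w by simp
    have rw_closed: "set (rotate1 w) \<subseteq> carrier F" using w_closed by simp
    have hom_closed: "\<And>h. h \<in> carrier F \<Longrightarrow> \<phi> h \<in> carrier F" using hom by (rule hom_in_carrier)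
    interpret \<phi>: group_hom F F \<phi> by unfold_locales (fact hom)
    obtain h where h: "h \<in> carrier F" "word_prod F (rotate1 w) = h \<otimes> word_prod F w \<otimes> inv h"
      using word_prod_rotate_conjugate[OF w_closed, of 1] by (auto simp: conjugate_in_def)
    then have "\<phi> (word_prod F (rotate1 w)) = \<phi> h \<otimes> \<phi> (word_prod F w) \<otimes> inv (\<phi> h)"
      using word_prod_closed[OF w_closed] by simp
    then have 1: "conjugate_in F (\<phi> (word_prod F w)) (\<phi> (word_prod F (rotate1 w)))"
      unfolding conjugate_in_def using hom_closed[OF h(1)] by blast
    have "\<phi> (word_prod F (rotate1 w)) = word_prod F (map \<phi> (rotate1 w))"
      by (rule hom_word_prod[OF hom is_group rw_closed])
    also have "map \<phi> (rotate1 w) = map f (rotate1 w)" using \<phi>(2) w by auto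
    also have "E ?n = E 0" by (simp add: E_def u_def mod_Suc)
    then have "word_prod F v = E 0 \<otimes> word_prod F (map f (rotate1 w)) \<otimes> inv (E 0)"
      using telescope[of ?n] rot word_prod_filter_one[OF \<rho>_closed] by (simp add: v_def)
    ultimately have "conjugate_in F (\<phi> (word_prod F (rotate1 w))) (word_prod F v)"
      unfolding conjugate_in_def using E_closed by metis
    then show ?thesis
      using conjugate_in_trans[OF 1] hom_closed word_prod_closed[OF w_closed] by blast
  qed
  ultimately show ?thesis using \<phi>(1) by blast
qed

text \<open>Pulling the word back along the inverse of \<open>\<phi>\<close> keeps the element
  \<open>z\<close> and moves the basis, so a shortening by an automorphism contradicts minimality
  over all bases.\<close>

lemma conjugate_word_transport:
  assumes \<phi>: "\<phi> \<in> iso F F" and v: "set v \<subseteq> L" and z: "z \<in> carrier F"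
    and conj: "conjugate_in F (\<phi> z) (word_prod F v)"
  shows "\<exists>B' v'. free_basis F B' \<and> set v' \<subseteq> letters F B' \<and> length v' = length v \<and>
    conjugate_in F z (word_prod F v')"
proof -
  define \<psi> where "\<psi> = inv_into (carrier F) \<phi>"
  have \<psi>: "\<psi> \<in> iso F F" unfolding \<psi>_def using \<phi> by (rule iso_set_sym)
  then have hom: "\<psi> \<in> hom F F" by (simp add: iso_def)
  interpret \<psi>: group_hom F F \<psi> by unfold_locales (fact hom)
  have \<phi>_closed: "\<phi> z \<in> carrier F" using \<phi> z by (auto simp: iso_def intro: hom_in_carrier)
  have "\<psi> (\<phi> z) = z" using \<phi> z by (simp add: \<psi>_def iso_def bij_betw_def inv_into_f_f)
  moreover obtain h where "h \<in> carrier F" "word_prod F v = h \<otimes> \<phi> z \<otimes> inv h"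
    using conj by (auto simp: conjugate_in_def)
  ultimately have "\<psi> (word_prod F v) = \<psi> h \<otimes> z \<otimes> inv (\<psi> h)" "\<psi> h \<in> carrier F"
    using \<phi>_closed by simp_all
  then have "conjugate_in F z (word_prod F (map \<psi> v))"
    unfolding conjugate_in_def using hom_word_prod[OF hom is_group, of v] v by auto
  moreover have "set (map \<psi> v) \<subseteq> letters F (\<psi> ` B)"
    using letters_image[OF hom] v by auto
  ultimately show ?thesis
    using free_basis_image[OF \<psi>] by (intro exI[of _ "\<psi> ` B"] exI[of _ "map \<psi> v"]) simp
qed

text \<open>Says that the Whitehead graph of a cyclically reduced word has no loops.\<close>

lemma cyc_adjacent:
  assumes "cyc w" "i < length w"
  shows "inv (w ! (Suc i mod length w)) \<noteq> w ! i"
proof -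
  have "hd (rotate (Suc i) w) \<noteq> inv (last (rotate (Suc i) w))"
    using assms by (intro cyc_hd_last cyc_rotate) auto
  then have "w ! (Suc i mod length w) \<noteq> inv (w ! i)"
    unfolding rotate_Suc_hd_last[OF assms(2)] .
  moreover have "w ! (Suc i mod length w) \<in> L"
    using red_letters[OF cyc_red[OF assms(1)]] assms(2) nth_mem[of "Suc i mod length w" w]
    by (metis gr_implies_not0 mod_less_divisor not_gr_zero subsetD)
  ultimately show ?thesis by (metis inv_inv letter_closed)
qed

theorem whitehead_imp_separable:
  assumes x: "x \<in> carrier F"
    and nontrivial: "\<not> (F \<cong> integer_group \<and> x = \<one>)"
    and whitehead: "\<not> graph_connected (whitehead_graph F B x) \<or>
      (\<exists>v. cut_vertex (whitehead_graph F B x) v)"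
    and minimal: "\<And>B' v. free_basis F B' \<Longrightarrow> set v \<subseteq> letters F B' \<Longrightarrow>
      conjugate_in F x (word_prod F v) \<Longrightarrow> length (cyclic_reduction F B x) \<le> length v"
  shows "separable F x"
proof -
  define w where "w = cyclic_reduction F B x"
  let ?n = "length w"
  let ?W = "whitehead_graph_word F B w"
  have cyc: "cyc w" and conj: "conjugate_in F x (word_prod F w)"
    using cyclic_reduction[OF x] by (simp_all add: w_def)
  have w: "set w \<subseteq> L" using red_letters[OF cyc_red[OF cyc]] .
  interpret W: wf_digraph ?W by (rule wf_digraph_whitehead[OF w])
  let ?t = "\<lambda>i. w ! i" and ?h = "\<lambda>i. inv (w ! (Suc i mod ?n))"
  have arcs: "arcs ?W = {..<?n}" "tail ?W = ?t" "head ?W = ?h" "verts ?W = L"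
    by (simp_all add: whitehead_graph_word_def)
  have no_shortening: False
    if S: "a \<in> L" "a \<notin> S" "inv a \<notin> S"
      "\<And>i. i < ?n \<Longrightarrow> ?t i \<in> S \<Longrightarrow> ?h i \<in> insert a S"
      "\<And>i. i < ?n \<Longrightarrow> ?h i \<in> S \<Longrightarrow> ?t i \<in> insert a S"
      "i < ?n" "?t i = a \<and> ?h i \<in> S \<or> ?t i \<in> S \<and> ?h i = a" for a S i
  proof -
    obtain \<phi> v where "\<phi> \<in> iso F F" "set v \<subseteq> L" "length v < ?n"
      "conjugate_in F (\<phi> (word_prod F w)) (word_prod F v)"
      using whitehead_automorphism_shortens[OF w S] by blast
    moreover have "word_prod F w \<in> carrier F" using w by simp
    ultimately obtain B' v' where "free_basis F B'" "set v' \<subseteq> letters F B'" "length v' < ?n"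
      "conjugate_in F (word_prod F w) (word_prod F v')"
      using conjugate_word_transport by metis
    then show False
      using minimal[of B' v'] conjugate_in_trans[OF conj _ x] by (simp add: w_def)
  qed
  show ?thesis
  proof (cases "graph_connected ?W")
    case True
    then obtain a where "cut_vertex ?W a" using whitehead by (auto simp: whitehead_graph_def w_def)
    then have a: "a \<in> L" "\<not> graph_connected (W.del_vert a)"
      using W.cut_vertex_iff[OF True] arcs by auto
    interpret D: wf_digraph "W.del_vert a" by (rule W.wf_digraph_del_vert)
    obtain C where "C \<subseteq> verts (W.del_vert a)" "C \<noteq> {}" "C \<noteq> verts (W.del_vert a)"
      and closed: "\<forall>e\<in>arcs (W.del_vert a).
        tail (W.del_vert a) e \<in> C \<longleftrightarrow> head (W.del_vert a) e \<in> C"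
      using D.not_graph_connected_closed_set[OF a(2)] by auto
    then have C: "C \<subseteq> L - {a}" "C \<noteq> {}" "C \<noteq> L - {a}"
      unfolding W.verts_del_vert arcs by simp_all
    have C_edge: "?t i \<in> C \<longleftrightarrow> ?h i \<in> C" if "i < ?n" "?t i \<noteq> a" "?h i \<noteq> a" for i
    proof -
      have "i \<in> arcs (W.del_vert a)" using that by (simp add: W.arcs_del_vert arcs)
      from closed[rule_format, OF this] show ?thesis
        by (simp only: W.tail_del_vert W.head_del_vert arcs)
    qed
    \<comment> \<open>Of the two sides left by the deletion of \<open>a\<close>, the one without
      \<open>inv a\<close> is chosen, as the automorphism with multiplier \<open>a\<close>
      requires.\<close>
    define S where "S = (if inv a \<in> C then L - {a} - C else C)"
    have S: "S \<subseteq> L" "S \<noteq> {}" "a \<notin> S" "inv a \<notin> S" using C(1-3) by (auto simp: S_def)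
    have th: "?t i \<in> L" "?h i \<in> L" if "i < ?n" for i
      using W.tail_in_verts[of i] W.head_in_verts[of i] that unfolding arcs by auto
    have S_edge: "?t i \<in> S \<longleftrightarrow> ?h i \<in> S" if "i < ?n" "?t i \<noteq> a" "?h i \<noteq> a" for i
      using C_edge[OF that] th[OF that(1)] that(2,3) by (simp add: S_def)
    have edges: "?t i \<in> S \<Longrightarrow> ?h i \<in> insert a S" "?h i \<in> S \<Longrightarrow> ?t i \<in> insert a S" if "i < ?n" for i
      using S_edge[OF that] S(3) by auto
    \<comment> \<open>Otherwise no edge would leave \<open>S\<close> at all, although the graph is
      connected and \<open>a\<close> lies outside.\<close>
    have "\<exists>i<?n. ?t i = a \<and> ?h i \<in> S \<or> ?t i \<in> S \<and> ?h i = a"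
    proof (rule ccontr)
      assume *: "\<not> ?thesis"
      obtain s where s: "s \<in> S" using S(2) by blast
      have "(s \<in> S) = (a \<in> S)"
        using True
      proof (rule graph_connected_cong)
        fix i assume "i \<in> arcs ?W"
        then have "i < ?n" by (simp add: arcs)
        then show "(tail ?W i \<in> S) = (head ?W i \<in> S)"
          unfolding arcs using edges[of i] * by blast
      qed (use s S a arcs in auto)
      then show False using s S(3) by simp
    qed
    then show ?thesis using no_shortening[OF a(1) S(3,4) edges] by blast
  next
    case False
    obtain C where "C \<subseteq> verts ?W" "C \<noteq> {}" "C \<noteq> verts ?W"
      "\<forall>e\<in>arcs ?W. tail ?W e \<in> C \<longleftrightarrow> head ?W e \<in> C"
      using W.not_graph_connected_closed_set[OF False] by auto
    then have C: "C \<subseteq> L" "C \<noteq> {}" "C \<noteq> L" "\<And>i. i < ?n \<Longrightarrow> ?t i \<in> C \<longleftrightarrow> ?h i \<in> C"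
      unfolding arcs by simp_all
    show ?thesis
    proof (cases "\<forall>l\<in>L. l \<in> set w \<or> inv l \<in> set w")
      case False
      then obtain b where b: "b \<in> L" "b \<notin> set w" "inv b \<notin> set w" by blast
      \<comment> \<open>Equality would leave no letters for \<open>w\<close>, so that
        \<open>x = \<one>\<close> in an infinite cyclic group, the excluded case.\<close>
      have "{b, inv b} \<noteq> L"
      proof
        assume L: "{b, inv b} = L"
        then have "w = []" using w b by (cases w) auto
        then have "x = \<one>"
          using conj conjugate_in_sym[OF conj x] by (auto simp: conjugate_in_def)
        moreover have "F \<cong> integer_group" using iso_integer_group[OF b(1)] L by simp
        ultimately show False using nontrivial by blast
      qed
      then show ?thesis
        using b by (intro separable_if_invariant_letters[OF x w conj, of "{b, inv b}"]) auto
    next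
      case True
      \<comment> \<open>A letter \<open>c\<close> violating this would serve as multiplier with
        \<open>S = C - {c}\<close>: edges at \<open>c\<close> stay in \<open>C\<close>, and as there
        are no loops they end in \<open>S\<close>.\<close>
      have C_inv: "inv c \<in> C" if c: "c \<in> C" for c
      proof (rule ccontr)
        assume c': "inv c \<notin> C"
        have cL: "c \<in> L" using c C(1) by blast
        have edges: "?t i \<in> C - {c} \<Longrightarrow> ?h i \<in> insert c (C - {c})"
          "?h i \<in> C - {c} \<Longrightarrow> ?t i \<in> insert c (C - {c})" if "i < ?n" for i
          using C(4)[OF that] by auto
        have "\<exists>i<?n. ?t i = c \<and> ?h i \<in> C - {c} \<or> ?t i \<in> C - {c} \<and> ?h i = c"
        proof (cases "c \<in> set w")
          case True
          then obtain i where "i < ?n" "?t i = c" by (auto simp: in_set_conv_nth)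
          then show ?thesis using C(4)[of i] c cyc_adjacent[OF cyc, of i] by auto
        next
          case False
          \<comment> \<open>The edge just before an occurrence of \<open>inv c\<close> has head
            \<open>c\<close>, so \<open>c\<close> still has an incident edge.\<close>
          then have "inv c \<in> set w" using True cL by blast
          then obtain k where k: "k < ?n" "w ! k = inv c" by (auto simp: in_set_conv_nth)
          define i where "i = (k + ?n - 1) mod ?n"
          have n: "?n > 0" using k(1) by linarith
          have "Suc i mod ?n = Suc (k + ?n - 1) mod ?n" unfolding i_def by (rule mod_Suc_eq)
          also have "\<dots> = k" using n k(1) by simp
          finally have i: "i < ?n" "?h i = c" using n k cL by (auto simp: i_def)
          then show ?thesis using C(4)[of i] c cyc_adjacent[OF cyc, of i] by auto
        qed
        then show False using no_shortening[of c "C - {c}", OF cL _ _ edges] c' by blast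
      qed
      \<comment> \<open>Edges respect \<open>C\<close>, and so does inversion; hence consecutive
        letters of \<open>w\<close> lie on the same side.\<close>
      have step: "w ! i \<in> C \<longleftrightarrow> w ! (Suc i mod ?n) \<in> C" if "i < ?n" for i
      proof -
        have "w ! (Suc i mod ?n) \<in> L"
          using W.head_in_verts[of i] that w nth_mem[of "Suc i mod ?n" w]
          by (metis gr_implies_not0 mod_less_divisor not_gr_zero subsetD)
        then show ?thesis using C(4)[OF that] C_inv by (metis inv_inv letter_closed)
      qed
      have "w ! i \<in> C \<longleftrightarrow> w ! 0 \<in> C" if "i < ?n" for i
        using that
      proof (induction i)
        case (Suc i)
        then show ?case using step[of i] by simp
      qed simp
      then have "set w \<subseteq> C \<or> set w \<inter> C = {}" by (fastforce simp: in_set_conv_nth)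
      then show ?thesis
        using separable_if_invariant_letters[OF x w conj C(1-3) C_inv] by blast
    qed
  qed
qed

end

theorem corollary3p11:
  fixes F :: "('a, 'm) monoid_scheme" and x :: 'a
  assumes "free_group F"
    and "x \<in> carrier F"
    and "\<not> (F \<cong> integer_group \<and> x = \<one>\<^bsub>F\<^esub>)"
  shows "separable F x \<longleftrightarrow>
    (\<forall>B. free_basis F B \<longrightarrow>
       \<not> graph_connected (whitehead_graph F B x) \<or>
       (\<exists>v. cut_vertex (whitehead_graph F B x) v))"
proof
  have F: "group F" using assms(1) by (simp add: free_group_def)
  {
    assume sep: "separable F x"
    show "\<forall>B. free_basis F B \<longrightarrow> \<not> graph_connected (whitehead_graph F B x) \<or>
       (\<exists>v. cut_vertex (whitehead_graph F B x) v)"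
    proof (intro allI impI)
      fix B assume "free_basis F B"
      then interpret based_free_group F B
        using F by (simp add: based_free_group_def based_free_group_axioms_def)
      show "\<not> graph_connected (whitehead_graph F B x) \<or> (\<exists>v. cut_vertex (whitehead_graph F B x) v)"
        using separable_imp_whitehead[OF assms(2) sep] .
    qed
  }
  assume whitehead: "\<forall>B. free_basis F B \<longrightarrow> \<not> graph_connected (whitehead_graph F B x) \<or>
       (\<exists>v. cut_vertex (whitehead_graph F B x) v)"
  \<comment> \<open>Basis and word are minimised together. The minimal word need not be
    \<open>cyclic_reduction F B x\<close>, but the latter is no longer, by
    \<open>cyc_length_minimal\<close>.\<close>
  let ?P = "\<lambda>(B, v). free_basis F B \<and> set v \<subseteq> letters F B \<and> conjugate_in F x (word_prod F v)"
  obtain B\<^sub>0 where "free_basis F B\<^sub>0" using assms(1) by (auto simp: free_group_def)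
  then interpret B\<^sub>0: based_free_group F B\<^sub>0
    using F by (simp add: based_free_group_def based_free_group_axioms_def)
  have "?P (B\<^sub>0, cyclic_reduction F B\<^sub>0 x)"
    using B\<^sub>0.basis B\<^sub>0.cyclic_reduction[OF assms(2)] B\<^sub>0.red_letters[OF B\<^sub>0.cyc_red] by simp
  then obtain B v where B: "free_basis F B" and v: "set v \<subseteq> letters F B" "conjugate_in F x (word_prod F v)"
    and min: "\<And>B' v'. free_basis F B' \<Longrightarrow> set v' \<subseteq> letters F B' \<Longrightarrow>
      conjugate_in F x (word_prod F v') \<Longrightarrow> length v \<le> length v'"
    using ex_has_least_nat[of ?P _ "\<lambda>(B, v). length v"] by fastforce
  interpret based_free_group F B
    using F B by (simp add: based_free_group_def based_free_group_axioms_def)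
  have "conjugate_in F (word_prod F v) (word_prod F (cyclic_reduction F B x))"
    using B\<^sub>0.conjugate_in_trans[OF B\<^sub>0.conjugate_in_sym[OF v(2) assms(2)]
      cyclic_reduction(2)[OF assms(2)]] v(1) by simp
  then have "length (cyclic_reduction F B x) \<le> length v"
    using cyc_length_minimal[OF cyclic_reduction(1)[OF assms(2)] v(1)] by simp
  then show "separable F x"
    using whitehead_imp_separable[OF assms(2,3)] whitehead B min by (meson le_trans)
qed

end
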